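(* Let $R_1>R_0>0$ and $a>0$, and let $f$ be a function on $\mathbb{R}^2$ supported within the disc of radius $R_1$ centered at the origin. Let $f_l$, $F_l$ and the contour $C$ be as defined in the context. Then, for every $l\in\mathbb{Z}$ and $r\in[0,R_1]$, integration over the positive real axis in the formula $$f_l(r)=\int_0^{\infty}F_l(\lambda)J_{|l|}(\lambda r)\,\lambda\,d\lambda$$ is equivalent to integration over the contour $C$ in the formula $$f_l(r)=\int_{C}F_l(\lambda)J_{|l|}(\lambda r)\,\lambda\,d\lambda ;$$ that is, the integral over the positive real values of $\lambda$ can be replaced by the integral over $C$ without changing the computed value of $f_l(r)$: $$\int_0^{\infty}F_l(\lambda)J_{|l|}(\lambda r)\,\lambda\,d\lambda=\int_{C}F_l(\lambda)J_{|l|}(\lambda r)\,\lambda\,d\lambda .$$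
   Context: $J_n$ denotes the Bessel function of the first kind of integer order $n$, viewed as an entire function of its argument. The angular Fourier coefficients of $f$ are $$f_l(r)=\frac{1}{2\pi}\int_0^{2\pi}e^{-il\theta}f(r\cos\theta,r\sin\theta)\,d\theta,\qquad l\in\mathbb{Z},$$ so that $f_l(r)=0$ for $r>R_1$. For $\lambda\in\mathbb{C}$ set $$F_l(\lambda)=\int_0^{\infty} r f_l(r)J_{|l|}(\lambda r)\,dr ,$$ which is an entire function of $\lambda$. The first formula for $f_l(r)$ in the claim is the inversion formula for this (self-invertible) Hankel transform. The function $F_l$ is related to the circular integrals of $f$ with centers on the circle of radius $R_0$ as follows. For $z=R_0(\cos\varphi,\sin\varphi)$ let $g(z,r)=r\int_{\mathbb{S}^1}f(z+ry)\,dy$, $\hat g(z,\lambda)=\int_0^\infty J_0(\lambda r)g(z,r)\,dr$, and $\hat g_l(\lambda)=\frac1{2\pi}\int_0^{2\pi}e^{-il\varphi}\hat g(z,\lambda)\,d\varphi$; then $F_l(\lambda)=\hat g_l(\lambda)/(2\pi J_{|l|}(\lambda R_0))$ wherever the denominator is nonzero. The contour $C\subset\mathbb{C}$ consists of the straight segment $[0,ia]$ from $0$ to $ia$ followed by the horizontal half-line $\{ia+M: M\ge 0\}$, traversed from $ia$ towards $ia+\infty$. Integrals over the unbounded contours are understood as limits of the integrals over the parts with $\operatorname{Re}\lambda\le b$ as $b\to\infty$. *)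

theory Defs
  imports "HOL-Complex_Analysis.Complex_Analysis"
begin

definition bessel_J :: "nat \<Rightarrow> complex \<Rightarrow> complex" where
  "bessel_J n z = (\<Sum>k. (-1) ^ k / (fact k * fact (k + n)) * (z / 2) ^ (2 * k + n))"

definition angular_coeff :: "(real \<times> real \<Rightarrow> complex) \<Rightarrow> int \<Rightarrow> real \<Rightarrow> complex" where
  "angular_coeff f l r =
     1 / (2 * of_real pi) *
     (LBINT \<theta>:{0..2*pi}. exp (- (\<i> * of_int l * of_real \<theta>)) * f (r * cos \<theta>, r * sin \<theta>))"

definition hankel_coeff :: "(real \<times> real \<Rightarrow> complex) \<Rightarrow> int \<Rightarrow> complex \<Rightarrow> complex" where
  "hankel_coeff f l z =
     (LBINT r:{0..}. of_real r * angular_coeff f l r * bessel_J (nat \<bar>l\<bar>) (z * of_real r))"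

definition inversion_integrand ::
    "(real \<times> real \<Rightarrow> complex) \<Rightarrow> int \<Rightarrow> real \<Rightarrow> complex \<Rightarrow> complex" where
  "inversion_integrand f l r z =
     hankel_coeff f l z * bessel_J (nat \<bar>l\<bar>) (z * of_real r) * z"

text \<open>For \<open>b \<ge> 0\<close>, the following two paths are the parts lying in \<open>Re z \<le> b\<close> of the
  positive real axis and of the contour consisting of the segment from \<open>0\<close> to \<open>\<i> a\<close> followed by
  the half-line from \<open>\<i> a\<close> to \<open>\<i> a + \<infinity>\<close>.\<close>

definition axis_part :: "real \<Rightarrow> real \<Rightarrow> complex" where
  "axis_part b = linepath 0 (of_real b)"

definition contour_part :: "real \<Rightarrow> real \<Rightarrow> real \<Rightarrow> complex" where
  "contour_part a b =
     linepath 0 (\<i> * of_real a) +++ linepath (\<i> * of_real a) (\<i> * of_real a + of_real b)"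

text \<open>An integral over an unbounded contour is the limit of the integrals over its truncations
  \<open>\<gamma> b\<close> as \<open>b \<rightarrow> \<infinity>\<close>; the predicate says that this limit exists and equals \<open>I\<close>.\<close>

definition has_unbounded_contour_integral ::
    "(complex \<Rightarrow> complex) \<Rightarrow> complex \<Rightarrow> (real \<Rightarrow> real \<Rightarrow> complex) \<Rightarrow> bool" where
  "has_unbounded_contour_integral h I \<gamma> \<longleftrightarrow>
     (\<forall>b\<ge>0. h contour_integrable_on \<gamma> b) \<and>
     ((\<lambda>b. contour_integral (\<gamma> b) h) \<longlongrightarrow> I) at_top"

definition continuously_differentiable :: "(real \<times> real \<Rightarrow> complex) \<Rightarrow> bool" where
  "continuously_differentiable f \<longleftrightarrow>
     (\<exists>f' :: real \<times> real \<Rightarrow> (real \<times> real) \<Rightarrow>\<^sub>L complex.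
        (\<forall>x. (f has_derivative blinfun_apply (f' x)) (at x)) \<and> continuous_on UNIV f')"

end

theory Submission imports Defs begin

text \<open>
Write \<open>G\<close> for the integrand, a function of the spectral variable. It is entire and bounded by
\<open>C |z| exp ((R1 + r) |Im z|)\<close>, because \<open>|J_n(w)| \<le> exp |Im w|\<close>. Hence it has an entire primitive \<open>H\<close>
with \<open>H 0 = 0\<close>, of the same exponential type, and the two truncated contour integrals are \<open>H b\<close> and
\<open>H (b + \<i> a)\<close>. The equivalence thus compares the limits of one function along two horizontal
half-lines.

For a function \<open>f\<close> that is only integrable, size estimates do not show that the integral
\<open>H (b + \<i> a) - H b\<close> over the closing vertical segment tends to \<open>0\<close>: at \<open>l = 0\<close> and \<open>r = 0\<close>, where the
second Bessel factor is constant, the bounds that they give grow with \<open>b\<close>. What saves the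
argument is a property of functions of exponential type (lemma \<open>tendsto_horizontal_line\<close>):
a limit along one horizontal half-line forces the same limit along every other one. To pass to a lower line, multiply by \<open>exp (- \<i> A z)\<close>, which cancels the growth of the
function in the lower half-plane, and by a power of a rational function with its pole above the
first line, which makes everything decay. Cauchy's formula on a large rectangle below the first
line then expresses the value on the lower line by values on the first line, up to \<open>O(1/b)\<close>. Complex
conjugation gives the passage to a higher line.

For continuously differentiable \<open>f\<close> it remains to prove the Hankel inversion formula on the real
axis. It is the angular Fourier coefficient of a Fourier inversion formula in the plane, in which
the frequencies are cut off at \<open>|\<xi>| \<le> b\<close>. By the addition theorem (lemma \<open>bessel_J_addition\<close>), \<open>G\<close> is
the \<open>l\<close>-th Fourier coefficient, over the circle of radius \<open>r\<close>, of the convolution of \<open>f\<close> with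
\<open>t J_0(t |y|)\<close>, up to a constant factor. Integration over \<open>t \<in> [0, b]\<close> turns this kernel into
\<open>b J_1(b |y|) / |y|\<close>. In polar coordinates around a point \<open>x\<close> the factor \<open>1 / |y|\<close> disappears, and since
\<open>b J_1(b \<rho>)\<close> is the derivative of \<open>- J_0(b \<rho>)\<close>, integration by parts along each ray gives \<open>f x\<close> and an
error of at most \<open>sup |f'|\<close> times the integral of \<open>|J_0(b \<rho>)|\<close> over a bounded interval. The error tends
to \<open>0\<close> as \<open>b \<rightarrow> \<infinity>\<close>, uniformly for \<open>x\<close> on the circle, because \<open>J_0\<close> vanishes at infinity.
\<close>

section \<open>Bessel functions of integer order\<close>

text \<open>
The factorisation \<open>J_n(z) = (z/2)^n \<Phi>_n(z^2)\<close> turns the Bessel series into an ordinary power series,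
so that termwise differentiation applies.
\<close>

definition bessel_profile :: "nat \<Rightarrow> complex \<Rightarrow> complex" where
  "bessel_profile n w = (\<Sum>k. (-1/4) ^ k / (fact k * fact (k + n)) * w ^ k)"

lemma norm_bessel_profile_term_le:
  "norm ((-1/4) ^ k / (fact k * fact (k + n)) * w ^ k :: complex) \<le> norm w ^ k / fact k"
proof -
  have f1: "(1::real) \<le> fact (k + n)" by (rule fact_ge_1)
  have "norm ((-1/4) ^ k / (fact k * fact (k + n)) * w ^ k :: complex)
      = (1/4) ^ k * (norm w ^ k / fact k) / fact (k + n)"
    by (simp add: norm_mult norm_divide norm_power)
  also have "\<dots> \<le> 1 * (norm w ^ k / fact k) / 1"
    by (intro frac_le mult_right_mono power_le_one) (auto simp: f1)
  finally show ?thesis by simp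
qed

lemma summable_norm_bessel_profile:
  "summable (\<lambda>k. norm ((-1/4) ^ k / (fact k * fact (k + n)) * w ^ k :: complex))"
proof (rule summable_comparison_test)
  show "\<exists>N. \<forall>k\<ge>N. norm (norm ((-1/4) ^ k / (fact k * fact (k + n)) * w ^ k :: complex)) \<le> norm w ^ k / fact k"
    using norm_bessel_profile_term_le by auto
  show "summable (\<lambda>k. norm w ^ k / fact k)"
    using summable_exp_generic[of "norm w"] by (simp add: field_simps)
qed

lemma bessel_profile_sums:
  "(\<lambda>k. (-1/4) ^ k / (fact k * fact (k + n)) * w ^ k) sums bessel_profile n w"
  unfolding bessel_profile_def
  by (rule summable_sums[OF summable_norm_cancel[OF summable_norm_bessel_profile]])

lemma bessel_J_term_eq:
  "(-1) ^ k / (fact k * fact (k + n)) * (z / 2) ^ (2 * k + n)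
    = (z / 2) ^ n * ((-1/4) ^ k / (fact k * fact (k + n)) * (z ^ 2) ^ k :: complex)"
proof -
  have "(-1) ^ k * (z / 2) ^ (2 * k) = (-1/4) ^ k * (z ^ 2) ^ k"
  proof -
    have "(-1) ^ k * (z / 2) ^ (2 * k) = ((-1) * (z / 2) ^ 2) ^ k"
      by (simp only: power_mult power_mult_distrib)
    also have "(-1) * (z / 2) ^ 2 = (-1/4) * z ^ 2"
      by (simp add: power_divide)
    finally show ?thesis by (simp only: power_mult_distrib)
  qed
  then show ?thesis by (simp add: power_add)
qed

lemma bessel_J_eq_profile: "bessel_J n z = (z / 2) ^ n * bessel_profile n (z ^ 2)"
  unfolding bessel_J_def bessel_J_term_eq
  by (rule sums_unique[OF sums_mult[OF bessel_profile_sums], symmetric])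

lemma bessel_J_sums:
  "(\<lambda>k. (-1) ^ k / (fact k * fact (k + n)) * (z / 2) ^ (2 * k + n)) sums bessel_J n z"
  unfolding bessel_J_term_eq bessel_J_eq_profile by (intro sums_mult bessel_profile_sums)

lemma bessel_profile_deriv:
  "(bessel_profile n has_field_derivative - bessel_profile (Suc n) w / 4) (at w)"
proof -
  let ?c = "\<lambda>k. (-1/4) ^ k / (fact k * fact (k + n)) :: complex"
  have "((\<lambda>x. \<Sum>k. ?c k * x ^ k) has_field_derivative (\<Sum>k. diffs ?c k * w ^ k)) (at w)"
    by (rule termdiffs_strong_converges_everywhere)
       (use bessel_profile_sums sums_summable in blast)
  moreover have "diffs ?c k * w ^ k = - 1 / 4 * ((-1/4) ^ k / (fact k * fact (k + Suc n)) * w ^ k)" for k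
  proof -
    have "(of_nat (Suc k) :: complex) \<noteq> 0" by (simp only: of_nat_eq_0_iff)
    then have "of_nat (Suc k) * (X / (of_nat (Suc k) * fact k * Y)) = X / (fact k * Y)" for X Y :: complex
      by (simp add: field_simps del: of_nat_Suc)
    then show ?thesis
      by (simp add: diffs_def fact_Suc del: of_nat_Suc)
  qed
  ultimately show ?thesis
    using sums_unique[OF sums_mult[OF bessel_profile_sums, of "-1/4" "Suc n" w]]
    unfolding bessel_profile_def by simp
qed

text \<open>
Up to scaling, this is the recurrence that expresses \<open>(z J_1(z))' = z J_0(z)\<close> on the level of power series.
\<close>

lemma bessel_profile_rec: "bessel_profile 1 w - w / 4 * bessel_profile 2 w = bessel_profile 0 w"
proof -
  let ?d = "\<lambda>k. if k = 0 then 0 else (-1/4) ^ k / (fact (k - 1) * fact (k + 1)) * w ^ k :: complex"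
  have "(\<lambda>k. (-1/4 * w) * ((-1/4) ^ k / (fact k * fact (k + 2)) * w ^ k)) sums (-1/4 * w * bessel_profile 2 w)"
    by (rule sums_mult[OF bessel_profile_sums])
  then have "(\<lambda>k. ?d (Suc k)) sums (-1/4 * w * bessel_profile 2 w)"
    by (simp add: mult_ac)
  then have "?d sums (-1/4 * w * bessel_profile 2 w)"
    using sums_Suc_iff[of ?d "-1/4 * w * bessel_profile 2 w"] by simp
  from sums_add[OF bessel_profile_sums[of 1 w] this]
  have *: "(\<lambda>k. (-1/4) ^ k / (fact k * fact (k + 1)) * w ^ k + ?d k) sums
     (bessel_profile 1 w - w / 4 * bessel_profile 2 w)" by simp
  have "(-1/4) ^ k / (fact k * fact (k + 1)) * w ^ k + ?d k
      = (-1/4) ^ k / (fact k * fact (k + 0)) * w ^ k" for k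
  proof (cases k)
    case (Suc m)
    have *: "1 / ((N * F) * ((N + 1) * (N * F))) + 1 / (F * ((N + 1) * (N * F))) = 1 / ((N * F) * (N * F))"
      if "N \<noteq> 0" "N + 1 \<noteq> 0" "F \<noteq> 0" for N F :: complex
      using that by (simp add: divide_simps)
    have "of_nat (Suc m) \<noteq> (0::complex)" "of_nat (Suc (Suc m)) \<noteq> (0::complex)"
      by (simp_all only: of_nat_eq_0_iff)
    then have "1 / (fact (Suc m) * fact (Suc (Suc m))) + 1 / (fact m * fact (Suc (Suc m)))
      = 1 / (fact (Suc m) * fact (Suc m) :: complex)"
      using *[of "of_nat (Suc m)" "fact m"] by (simp add: fact_Suc add.commute)
    then have "X * (1 / (fact (Suc m) * fact (Suc (Suc m))) + 1 / (fact m * fact (Suc (Suc m))))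
      = X * (1 / (fact (Suc m) * fact (Suc m) :: complex))" for X by simp
    from this[of "(-1/4) ^ k * w ^ k"] Suc show ?thesis
      by (simp only: distrib_left) (simp del: fact_Suc)
  qed simp
  then have "(\<lambda>k. (-1/4) ^ k / (fact k * fact (k + 0)) * w ^ k) sums
     (bessel_profile 1 w - w / 4 * bessel_profile 2 w)" using * by simp
  with bessel_profile_sums[of 0 w] show ?thesis by (rule sums_unique2[symmetric])
qed

lemma bessel_J_0_deriv [derivative_intros]:
  "(bessel_J 0 has_field_derivative - bessel_J 1 z) (at z)"
proof -
  have "((\<lambda>z. bessel_profile 0 (z ^ 2)) has_field_derivative
     (- bessel_profile (Suc 0) (z ^ 2) / 4) * (2 * z)) (at z)"
    by (rule DERIV_chain'[OF _ bessel_profile_deriv]) (auto intro!: derivative_eq_intros)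
  then show ?thesis by (simp add: bessel_J_eq_profile[abs_def])
qed

lemma z_bessel_J_1_deriv:
  "((\<lambda>z. z * bessel_J 1 z) has_field_derivative z * bessel_J 0 z) (at z)"
proof -
  have d: "((\<lambda>z. bessel_profile 1 (z ^ 2)) has_field_derivative
     (- bessel_profile 2 (z ^ 2) / 4) * (2 * z)) (at z)"
    by (rule DERIV_chain'[OF _ bessel_profile_deriv[of 1, unfolded Suc_1]])
       (auto intro!: derivative_eq_intros)
  have "((\<lambda>z. z ^ 2 / 2 * bessel_profile 1 (z ^ 2)) has_field_derivative
     z * (bessel_profile 1 (z ^ 2) - z ^ 2 / 4 * bessel_profile 2 (z ^ 2))) (at z)"
    by (rule derivative_eq_intros d refl | simp)+ (simp add: field_simps power2_eq_square)
  then show ?thesis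
    unfolding bessel_profile_rec by (simp add: bessel_J_eq_profile power2_eq_square mult.assoc)
qed

lemma holomorphic_bessel_J: "bessel_J n holomorphic_on A"
proof -
  have "bessel_profile n holomorphic_on UNIV"
    using bessel_profile_deriv by (auto simp: holomorphic_on_def field_differentiable_def
      intro: DERIV_subset)
  then have "(bessel_profile n \<circ> (\<lambda>z. z ^ 2)) holomorphic_on A"
    by (intro holomorphic_on_compose holomorphic_intros) (auto elim: holomorphic_on_subset)
  then show ?thesis
    unfolding bessel_J_eq_profile[abs_def] comp_def by (intro holomorphic_intros) auto
qed

lemma continuous_on_bessel_J [continuous_intros]:
  "continuous_on A g \<Longrightarrow> continuous_on A (\<lambda>x. bessel_J n (g x))"
  using continuous_on_compose2[OF holomorphic_on_imp_continuous_on[OF holomorphic_bessel_J[of n UNIV]]]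
  by blast

lemma bessel_J_minus: "bessel_J n (- z) = (-1) ^ n * bessel_J n z"
proof -
  have "(- z / 2) ^ n = (-1) ^ n * (z / 2) ^ n"
    by (metis minus_divide_left power_minus)
  then show ?thesis by (simp add: bessel_J_eq_profile)
qed

lemma bessel_J_cnj: "bessel_J n (cnj z) = cnj (bessel_J n z)"
proof -
  have "(\<lambda>k. cnj ((-1/4) ^ k / (fact k * fact (k + n)) * (z ^ 2) ^ k)) sums cnj (bessel_profile n (z ^ 2))"
    unfolding sums_cnj by (rule bessel_profile_sums)
  then have "(\<lambda>k. (-1/4) ^ k / (fact k * fact (k + n)) * (cnj z ^ 2) ^ k) sums cnj (bessel_profile n (z ^ 2))"
    by simp
  with bessel_profile_sums have "bessel_profile n (cnj z ^ 2) = cnj (bessel_profile n (z ^ 2))"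
    by (rule sums_unique2)
  then show ?thesis by (simp add: bessel_J_eq_profile)
qed

lemma bessel_J_0_0 [simp]: "bessel_J 0 0 = 1"
  using sums_unique2[OF bessel_profile_sums[of 0 0] powser_sums_zero] by (simp add: bessel_J_eq_profile)

text \<open>
Cauchy's formula for the \<open>m\<close>-th derivative of \<open>exp (c w)\<close> at \<open>0\<close>, written on the unit circle.
\<close>

lemma has_integral_exp_fourier_coeff:
  "((\<lambda>t. exp (c * cis t) * cis (- (real m * t))) has_integral 2 * of_real pi * (c ^ m / fact m)) {0..2*pi}"
proof -
  have d: "(deriv ^^ m) (\<lambda>w. exp (c * w)) = (\<lambda>w. c ^ m * exp (c * w))" for m
  proof (induction m)
    case (Suc m)
    have "deriv (\<lambda>w. c ^ m * exp (c * w)) w = c ^ Suc m * exp (c * w)" for w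
      by (rule DERIV_imp_deriv) (auto intro!: derivative_eq_intros)
    then show ?case using Suc by auto
  qed simp
  have "((\<lambda>u. exp (c * u) / (u - 0) ^ Suc m) has_contour_integral
      2 * pi * \<i> / fact m * (deriv ^^ m) (\<lambda>w. exp (c * w)) 0) (circlepath 0 1)"
    by (intro Cauchy_has_contour_integral_higher_derivative_circlepath continuous_intros holomorphic_intros) auto
  then have "((\<lambda>t. exp (c * cis t) / cis t ^ Suc m * 1 * \<i> * cis t) has_integral
      2 * pi * \<i> / fact m * c ^ m) {0..2*pi}"
    unfolding circlepath_def by (subst (asm) has_contour_integral_part_circlepath_iff) (auto simp: d)
  then have "((\<lambda>t. - \<i> * (exp (c * cis t) / cis t ^ Suc m * 1 * \<i> * cis t)) has_integral
      - \<i> * (2 * pi * \<i> / fact m * c ^ m)) {0..2*pi}"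
    by (rule has_integral_mult_right)
  moreover have "- \<i> * (exp (c * cis t) / cis t ^ Suc m * 1 * \<i> * cis t) = exp (c * cis t) * cis (- (real m * t))" for t
  proof -
    have "cis (- (real m * t)) = inverse (cis t ^ m)" by (simp add: Complex.DeMoivre flip: cis_inverse)
    then show ?thesis by (simp add: field_simps)
  qed
  ultimately show ?thesis by (simp add: mult_ac)
qed

text \<open>
Bessel's integral, in a form that allows a phase shift. With \<open>w = e^{it}\<close> the exponential is
\<open>exp (c w) exp (d / w)\<close>. Expanding only the second factor gives a uniformly convergent series, and
integrating it term by term against \<open>w^{-n}\<close> picks one Taylor coefficient of \<open>exp (c w)\<close> each time;
the resulting series is that of \<open>J_n\<close>.
\<close>

lemma has_integral_bessel_nat:
  "((\<lambda>t. exp (\<i> * z * of_real (cos (t - \<alpha>))) * cis (- (real n * t))) has_integral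
     2 * of_real pi * \<i> ^ n * cis (- (real n * \<alpha>)) * bessel_J n z) {0..2*pi}"
proof -
  \<comment> \<open>\<open>\<i> z cos (t - \<alpha>) = c e^{it} + d e^{-it}\<close>\<close>
  define c where "c = \<i> * z / 2 * cis (- \<alpha>)"
  define d where "d = \<i> * z / 2 * cis \<alpha>"
  define g where "g = (\<lambda>k t. (exp (c * cis t) * cis (- (real (k + n) * t))) * (d ^ k / fact k))"
  have e: "exp (\<i> * z * of_real (cos (t - \<alpha>))) * cis (- (real n * t))
      = exp (c * cis t) * exp (d * cis (- t)) * cis (- (real n * t))" for t
  proof -
    have "of_real (cos (t - \<alpha>)) = (cis (t - \<alpha>) + cis (\<alpha> - t)) / 2"
      by (simp add: complex_eq_iff cos_diff sin_diff)
    moreover have "cis (t - \<alpha>) = cis (- \<alpha>) * cis t" "cis (\<alpha> - t) = cis \<alpha> * cis (- t)"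
      by (simp_all add: cis_mult)
    ultimately have "\<i> * z * of_real (cos (t - \<alpha>)) = c * cis t + d * cis (- t)"
      by (simp add: c_def d_def field_simps)
    then show ?thesis by (simp add: exp_add)
  qed
  have gk: "(g k has_integral 2 * of_real pi * (c ^ (k + n) / fact (k + n)) * (d ^ k / fact k)) {0..2*pi}" for k
    unfolding g_def by (intro has_integral_mult_left has_integral_exp_fourier_coeff)
  have gt: "g k t = exp (c * cis t) * cis (- (real n * t)) * ((d * cis (- t)) ^ k / fact k)" for k t
  proof -
    have "cis (- (real (k + n) * t)) = cis (- (real k * t)) * cis (- (real n * t))"
      by (simp add: cis_mult algebra_simps)
    then show ?thesis by (simp add: g_def power_mult_distrib Complex.DeMoivre)
  qed
  have gs: "(\<lambda>k. g k t) sums (exp (\<i> * z * of_real (cos (t - \<alpha>))) * cis (- (real n * t)))" for t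
  proof -
    have "(\<lambda>k. (d * cis (- t)) ^ k / fact k) sums exp (d * cis (- t))"
      using exp_converges[of "d * cis (- t)"] by (simp add: scaleR_conv_of_real field_simps)
    from sums_mult[OF this, of "exp (c * cis t) * cis (- (real n * t))"] show ?thesis
      unfolding gt e by (simp add: mult_ac)
  qed
  have ul: "uniform_limit {0..2*pi} (\<lambda>N t. \<Sum>k<N. g k t) (\<lambda>t. \<Sum>k. g k t) sequentially"
  proof (rule Weierstrass_m_test)
    show "norm (g k t) \<le> exp (norm c) * (norm d ^ k / fact k)" if "t \<in> {0..2*pi}" for k t
    proof -
      have "norm (exp (c * cis t)) \<le> exp (norm c)"
        using norm_exp[of "c * cis t"] by (simp add: norm_mult)
      then show ?thesis
        unfolding g_def by (simp add: norm_mult norm_divide norm_power mult_right_mono divide_right_mono)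
    qed
    show "summable (\<lambda>k. exp (norm c) * (norm d ^ k / fact k))"
      using summable_exp_generic[of "norm d"] by (intro summable_mult) (simp add: field_simps)
  qed
  have "(\<lambda>k. \<i> ^ n * cis (- (real n * \<alpha>)) * ((-1) ^ k / (fact k * fact (k + n)) * (z / 2) ^ (2 * k + n)))
      sums (\<i> ^ n * cis (- (real n * \<alpha>)) * bessel_J n z)"
    by (intro sums_mult bessel_J_sums)
  moreover have "\<i> ^ n * cis (- (real n * \<alpha>)) * ((-1) ^ k / (fact k * fact (k + n)) * (z / 2) ^ (2 * k + n))
     = (c ^ (k + n) / fact (k + n)) * (d ^ k / fact k)" for k
  proof -
    have "c * d = - ((z / 2) ^ 2)"
      by (simp add: c_def d_def cis_mult power2_eq_square field_simps)
    then have "c ^ k * d ^ k = (-1) ^ k * (z / 2) ^ (2 * k)"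
      by (metis power_minus power_mult power_mult_distrib)
    moreover have "c ^ n = \<i> ^ n * (z / 2) ^ n * cis (- (real n * \<alpha>))"
      by (simp add: c_def power_mult_distrib power_divide Complex.DeMoivre)
    ultimately have "c ^ (k + n) * d ^ k = \<i> ^ n * cis (- (real n * \<alpha>)) * ((-1) ^ k * (z / 2) ^ (2 * k + n))"
      by (simp add: power_add mult_ac)
    then show ?thesis by (simp add: field_simps)
  qed
  ultimately have "(\<lambda>k. (c ^ (k + n) / fact (k + n)) * (d ^ k / fact k))
      sums (\<i> ^ n * cis (- (real n * \<alpha>)) * bessel_J n z)"
    by (simp only:)
  from sums_mult[OF this, of "2 * of_real pi"]
  have S: "(\<lambda>k. 2 * of_real pi * (c ^ (k + n) / fact (k + n)) * (d ^ k / fact k))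
      sums (2 * of_real pi * \<i> ^ n * cis (- (real n * \<alpha>)) * bessel_J n z)"
    by (simp only: mult.assoc)
  have "((\<lambda>t. \<Sum>k. g k t) has_integral (2 * of_real pi * \<i> ^ n * cis (- (real n * \<alpha>)) * bessel_J n z)) {0..2*pi}"
  proof -
    have P: "\<And>N. ((\<lambda>t. \<Sum>k<N. g k t) has_integral (\<Sum>k<N. 2 * of_real pi * (c ^ (k + n) / fact (k + n)) * (d ^ k / fact k))) {0..2*pi}"
      by (intro has_integral_sum gk) auto
    have co: "continuous_on {0..2*pi} (\<lambda>t. \<Sum>k<N. g k t)" for N
      unfolding g_def by (intro continuous_intros)
    obtain I J where IJ: "\<And>N. ((\<lambda>t. \<Sum>k<N. g k t) has_integral I N) {0..2*pi}"
       "((\<lambda>t. \<Sum>k. g k t) has_integral J) {0..2*pi}" "I \<longlonglongrightarrow> J"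
      using uniform_limit_integral[OF ul co] by auto
    have "I = (\<lambda>N. (\<Sum>k<N. 2 * of_real pi * (c ^ (k + n) / fact (k + n)) * (d ^ k / fact k)))"
      using P IJ(1) has_integral_unique by blast
    with IJ(3) S have "J = 2 * of_real pi * \<i> ^ n * cis (- (real n * \<alpha>)) * bessel_J n z"
      unfolding sums_def using LIMSEQ_unique by blast
    with IJ(2) show ?thesis by simp
  qed
  moreover have "(\<lambda>t. \<Sum>k. g k t) = (\<lambda>t. exp (\<i> * z * of_real (cos (t - \<alpha>))) * cis (- (real n * t)))"
    by (rule ext) (rule sums_unique[OF gs, symmetric])
  ultimately show ?thesis by simp
qed

text \<open>
Negative orders follow from positive ones by conjugating the integral for \<open>- cnj z\<close>.
\<close>

lemma has_integral_bessel:
  "((\<lambda>t. exp (\<i> * z * of_real (cos (t - \<alpha>))) * cis (- (of_int l * t))) has_integral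
     2 * of_real pi * \<i> ^ nat \<bar>l\<bar> * cis (- (of_int l * \<alpha>)) * bessel_J (nat \<bar>l\<bar>) z) {0..2*pi}"
proof (cases "l \<ge> 0")
  case True
  then show ?thesis using has_integral_bessel_nat[of z \<alpha> "nat l"] by simp
next
  case False
  define n where "n = nat \<bar>l\<bar>"
  have l: "of_int l = - real n" using False by (simp add: n_def)
  have "((\<lambda>t. cnj (exp (\<i> * (- cnj z) * of_real (cos (t - \<alpha>))) * cis (- (real n * t)))) has_integral
     cnj (2 * of_real pi * \<i> ^ n * cis (- (real n * \<alpha>)) * bessel_J n (- cnj z))) {0..2*pi}"
    using has_integral_bessel_nat[of "- cnj z" \<alpha> n, THEN has_integral_cnj[THEN iffD2]] by (simp only: comp_def)
  moreover have "(- \<i>) ^ n * ((-1) ^ n * X) = \<i> ^ n * X" for X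
  proof -
    have "(- \<i>) ^ n * (-1) ^ n = \<i> ^ n" by (simp flip: power_mult_distrib)
    then show ?thesis by (simp only: mult.assoc[symmetric])
  qed
  ultimately show ?thesis
    unfolding n_def[symmetric] l
    by (simp add: exp_cnj cis_cnj bessel_J_minus bessel_J_cnj mult_ac)
qed

text \<open>
The integrand of Bessel's integral has modulus at most \<open>exp |Im z|\<close>.
\<close>

lemma norm_bessel_J_le: "norm (bessel_J n z) \<le> exp \<bar>Im z\<bar>"
proof -
  have "norm (2 * of_real pi * \<i> ^ n * cis (- (real n * 0)) * bessel_J n z) \<le> exp \<bar>Im z\<bar> * measure lborel (cbox 0 (2*pi))"
  proof (rule has_integral_bound)
    show "((\<lambda>t. exp (\<i> * z * of_real (cos (t - 0))) * cis (- (real n * t))) has_integral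
     2 * of_real pi * \<i> ^ n * cis (- (real n * 0)) * bessel_J n z) (cbox 0 (2*pi))"
      using has_integral_bessel_nat[of z 0 n] by simp
    show "norm (exp (\<i> * z * of_real (cos (t - 0))) * cis (- (real n * t))) \<le> exp \<bar>Im z\<bar>" for t
    proof -
      have "- (Im z * cos t) \<le> \<bar>Im z\<bar> * \<bar>cos t\<bar>" by (simp flip: abs_mult)
      also have "\<dots> \<le> \<bar>Im z\<bar>" by (rule mult_left_le) auto
      finally show ?thesis by (simp add: norm_mult norm_exp_eq_Re)
    qed
  qed simp
  then show ?thesis by (simp add: norm_mult norm_power)
qed

lemma norm_bessel_J_real_le: "norm (bessel_J n (of_real t)) \<le> 1"
  using norm_bessel_J_le[of n "of_real t"] by simp

section \<open>Polar coordinates in the plane\<close>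

text \<open>
The substitution theorem needs compact intervals; exhausting the line by \<open>[-k, k]\<close> gives the full
substitution \<open>\<theta> = arctan s\<close>.
\<close>

lemma nn_integral_arctan:
  fixes G :: "real \<Rightarrow> ennreal"
  assumes [measurable]: "G \<in> borel_measurable borel"
  shows "(\<integral>\<^sup>+s. G (arctan s) * ennreal (1 / (1 + s\<^sup>2)) \<partial>lborel)
       = (\<integral>\<^sup>+\<theta>. G \<theta> * indicator {-(pi/2)<..<pi/2} \<theta> \<partial>lborel)"
proof -
  have eq: "(\<integral>\<^sup>+\<theta>. G \<theta> * indicator {arctan (- real k)..arctan (real k)} \<theta> \<partial>lborel)
     = (\<integral>\<^sup>+s. G (arctan s) * ennreal (1 / (1 + s\<^sup>2)) * indicator {- real k..real k} s \<partial>lborel)" for k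
  proof (cases "k = 0")
    case True
    have "AE x in lborel. x \<noteq> (0::real)" by (rule AE_lborel_singleton)
    then have "(\<integral>\<^sup>+\<theta>. G \<theta> * indicator {0} \<theta> \<partial>lborel) = 0"
      "(\<integral>\<^sup>+s. G (arctan s) * ennreal (1 / (1 + s\<^sup>2)) * indicator {0} s \<partial>lborel) = 0"
      by (subst nn_integral_0_iff_AE; auto simp: indicator_def)+
    with True show ?thesis by simp
  next
    case False
    then show ?thesis
      by (intro nn_integral_substitution_aux) (auto intro!: derivative_eq_intros continuous_intros
          simp: divide_inverse add_nonneg_eq_0_iff)
  qed
  have lim1: "(\<lambda>k. \<integral>\<^sup>+\<theta>. G \<theta> * indicator {arctan (- real k)..arctan (real k)} \<theta> \<partial>lborel) \<longlonglongrightarrow>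
       (\<integral>\<^sup>+\<theta>. G \<theta> * indicator {-(pi/2)<..<pi/2} \<theta> \<partial>lborel)"
  proof (rule nn_integral_LIMSEQ)
    show "incseq (\<lambda>k \<theta>. G \<theta> * indicator {arctan (- real k)..arctan (real k)} \<theta>)"
      by (auto simp: incseq_def le_fun_def indicator_def arctan_minus
          dest: arctan_monotone' intro: order_trans)
         (meson arctan_monotone' le_minus_iff neg_le_iff_le of_nat_mono order_trans)+
    show "(\<lambda>k. G \<theta> * indicator {arctan (- real k)..arctan (real k)} \<theta>) \<longlonglongrightarrow>
       G \<theta> * indicator {-(pi/2)<..<pi/2} \<theta>" for \<theta>
    proof (rule tendsto_eventually, cases "\<theta> \<in> {-(pi/2)<..<pi/2}")
      case True
      then have t: "arctan (tan \<theta>) = \<theta>" by (intro arctan_tan) auto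
      obtain K :: nat where K: "\<bar>tan \<theta>\<bar> \<le> real K" using real_arch_simple by blast
      have "\<theta> \<in> {arctan (- real k)..arctan (real k)}" if "k \<ge> K" for k
      proof -
        have "- real k \<le> tan \<theta>" "tan \<theta> \<le> real k" using K that by (auto simp: abs_le_iff)
        then have "arctan (- real k) \<le> arctan (tan \<theta>)" "arctan (tan \<theta>) \<le> arctan (real k)"
          by (simp_all only: arctan_le_iff)
        then show ?thesis by (simp only: t atLeastAtMost_iff)
      qed
      then show "\<forall>\<^sub>F k in sequentially. G \<theta> * indicator {arctan (- real k)..arctan (real k)} \<theta>
          = G \<theta> * indicator {-(pi/2)<..<pi/2} \<theta>"
        using True by (auto simp: eventually_sequentially intro!: exI[of _ K])
    next
      case False
      have "\<theta> \<notin> {arctan (- real k)..arctan (real k)}" for k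
        using False arctan_lbound[of "- real k"] arctan_ubound[of "real k"] by auto
      then show "\<forall>\<^sub>F k in sequentially. G \<theta> * indicator {arctan (- real k)..arctan (real k)} \<theta>
          = G \<theta> * indicator {-(pi/2)<..<pi/2} \<theta>"
        using False by (intro always_eventually allI) (simp only: indicator_simps not_False_eq_True)
    qed
  qed measurable
  have lim2: "(\<lambda>k. \<integral>\<^sup>+s. G (arctan s) * ennreal (1 / (1 + s\<^sup>2)) * indicator {- real k..real k} s \<partial>lborel) \<longlonglongrightarrow>
       (\<integral>\<^sup>+s. G (arctan s) * ennreal (1 / (1 + s\<^sup>2)) \<partial>lborel)"
  proof (rule nn_integral_LIMSEQ)
    show "incseq (\<lambda>k s. G (arctan s) * ennreal (1 / (1 + s\<^sup>2)) * indicator {- real k..real k} s)"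
      by (auto simp: incseq_def le_fun_def indicator_def)
    show "(\<lambda>k. G (arctan s) * ennreal (1 / (1 + s\<^sup>2)) * indicator {- real k..real k} s) \<longlonglongrightarrow>
       G (arctan s) * ennreal (1 / (1 + s\<^sup>2))" for s
    proof (rule tendsto_eventually)
      obtain K :: nat where K: "\<bar>s\<bar> \<le> real K" using real_arch_simple by blast
      then have "s \<in> {- real k..real k}" if "k \<ge> K" for k using that by (auto simp: abs_le_iff)
      then show "\<forall>\<^sub>F k in sequentially. G (arctan s) * ennreal (1 / (1 + s\<^sup>2)) * indicator {- real k..real k} s
          = G (arctan s) * ennreal (1 / (1 + s\<^sup>2))"
        by (auto simp: eventually_sequentially intro!: exI[of _ K])
    qed
  qed measurable
  from lim1 lim2 show ?thesis unfolding eq by (rule LIMSEQ_unique[symmetric])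
qed

text \<open>
Three one-dimensional substitutions and one exchange of integrals: \<open>y = x s\<close> for fixed \<open>x\<close>, then
\<open>x = r cos (arctan s)\<close> for fixed slope \<open>s\<close>, and finally \<open>s = tan \<theta>\<close>. The Jacobian \<open>r\<close> is assembled from
\<open>x dx = cos\<^sup>2 \<theta> r dr\<close> and \<open>ds = d\<theta> / cos\<^sup>2 \<theta>\<close>.
\<close>

lemma nn_integral_right_half_plane_polar:
  fixes F :: "real \<times> real \<Rightarrow> ennreal"
  assumes [measurable]: "F \<in> borel_measurable (borel \<Otimes>\<^sub>M borel)"
  shows "(\<integral>\<^sup>+x. \<integral>\<^sup>+y. F (x, y) * indicator {0<..} x \<partial>lborel \<partial>lborel)
     = (\<integral>\<^sup>+\<theta>. (\<integral>\<^sup>+r. F (r * cos \<theta>, r * sin \<theta>) * ennreal r * indicator {0<..} r \<partial>lborel)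
         * indicator {-(pi/2)<..<pi/2} \<theta> \<partial>lborel)"
proof -
  have "(\<integral>\<^sup>+y. F (x, y) * indicator {0<..} x \<partial>lborel)
      = (\<integral>\<^sup>+s. F (x, x * s) * ennreal x * indicator {0<..} x \<partial>lborel)" for x
  proof (cases "x > 0")
    case True
    have "(\<integral>\<^sup>+y. F (x, y) \<partial>lborel) = ennreal \<bar>x\<bar> * (\<integral>\<^sup>+s. F (x, 0 + x * s) \<partial>lborel)"
      by (rule nn_integral_real_affine) (use True in auto)
    also have "\<dots> = (\<integral>\<^sup>+s. F (x, x * s) * ennreal x \<partial>lborel)"
      using True by (subst nn_integral_cmult[symmetric]) (auto simp: mult.commute)
    finally show ?thesis using True by simp
  qed simp
  then have "(\<integral>\<^sup>+x. \<integral>\<^sup>+y. F (x, y) * indicator {0<..} x \<partial>lborel \<partial>lborel)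
      = (\<integral>\<^sup>+x. \<integral>\<^sup>+s. F (x, x * s) * ennreal x * indicator {0<..} x \<partial>lborel \<partial>lborel)" by simp
  also have "\<dots> = (\<integral>\<^sup>+s. \<integral>\<^sup>+x. F (x, x * s) * ennreal x * indicator {0<..} x \<partial>lborel \<partial>lborel)"
    by (rule lborel_pair.Fubini') measurable
  also have "\<dots> = (\<integral>\<^sup>+s. (\<integral>\<^sup>+r. F (r * cos (arctan s), r * sin (arctan s)) * ennreal r * indicator {0<..} r \<partial>lborel)
        * ennreal (1 / (1 + s\<^sup>2)) \<partial>lborel)"
  proof (rule nn_integral_cong)
    fix s :: real
    define c where "c = cos (arctan s)"
    have c: "c > 0" "c * c = 1 / (1 + s\<^sup>2)" "c * s = sin (arctan s)"
      by (auto simp: c_def cos_arctan sin_arctan add_pos_nonneg field_simps power2_eq_square)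
    have "(\<integral>\<^sup>+x. F (x, x * s) * ennreal x * indicator {0<..} x \<partial>lborel)
      = ennreal \<bar>c\<bar> * (\<integral>\<^sup>+r. F (0 + c * r, (0 + c * r) * s) * ennreal (0 + c * r) * indicator {0<..} (0 + c * r) \<partial>lborel)"
      by (rule nn_integral_real_affine) (use c in auto)
    also have "\<dots> = (\<integral>\<^sup>+r. ennreal \<bar>c\<bar> * (F (0 + c * r, (0 + c * r) * s) * ennreal (0 + c * r) * indicator {0<..} (0 + c * r)) \<partial>lborel)"
      by (rule nn_integral_cmult[symmetric]) measurable
    also have "\<dots> = (\<integral>\<^sup>+r. (F (r * cos (arctan s), r * sin (arctan s)) * ennreal r * indicator {0<..} r) * ennreal (1 / (1 + s\<^sup>2)) \<partial>lborel)"
    proof (rule nn_integral_cong)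
      fix r :: real
      have "ennreal \<bar>c\<bar> * ennreal (c * r) = ennreal r * ennreal (1 / (1 + s\<^sup>2))" if "r > 0"
        using that c(1) unfolding c(2)[symmetric] by (simp add: ennreal_mult'[symmetric] mult_ac)
      moreover have "(0 + c * r) * s = r * sin (arctan s)" "0 + c * r = r * cos (arctan s)"
        unfolding c(3)[symmetric] by (simp_all add: c_def)
      moreover have "indicator {0<..} (c * r) = (indicator {0<..} r :: ennreal)"
        using c(1) by (simp add: indicator_def zero_less_mult_iff)
      moreover have "X * (Y * Z * V) = (X * Z) * (Y * V)" "(Y * U * V) * W = (U * W) * (Y * V)"
        for X Y Z U V W :: ennreal
        by (simp_all add: mult_ac)
      ultimately show "ennreal \<bar>c\<bar> * (F (0 + c * r, (0 + c * r) * s) * ennreal (0 + c * r) * indicator {0<..} (0 + c * r))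
          = (F (r * cos (arctan s), r * sin (arctan s)) * ennreal r * indicator {0<..} r) * ennreal (1 / (1 + s\<^sup>2))"
        by (cases "r > 0") (simp_all only: add_0, simp_all)
    qed
    also have "\<dots> = (\<integral>\<^sup>+r. F (r * cos (arctan s), r * sin (arctan s)) * ennreal r * indicator {0<..} r \<partial>lborel)
        * ennreal (1 / (1 + s\<^sup>2))"
      by (rule nn_integral_multc) measurable
    finally show "(\<integral>\<^sup>+x. F (x, x * s) * ennreal x * indicator {0<..} x \<partial>lborel) = \<dots>" .
  qed
  also have "\<dots> = (\<integral>\<^sup>+\<theta>. (\<integral>\<^sup>+r. F (r * cos \<theta>, r * sin \<theta>) * ennreal r * indicator {0<..} r \<partial>lborel)
         * indicator {-(pi/2)<..<pi/2} \<theta> \<partial>lborel)"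
    by (rule nn_integral_arctan) measurable
  finally show ?thesis .
qed

lemma nn_integral_shift_indicator:
  fixes G :: "real \<Rightarrow> ennreal"
  assumes [measurable]: "G \<in> borel_measurable borel"
  shows "(\<integral>\<^sup>+\<theta>. G (\<theta> + a) * indicator {b<..<c} \<theta> \<partial>lborel) = (\<integral>\<^sup>+\<theta>. G \<theta> * indicator {b + a<..<c + a} \<theta> \<partial>lborel)"
proof -
  have "(\<integral>\<^sup>+\<theta>. G \<theta> * indicator {b + a<..<c + a} \<theta> \<partial>lborel)
     = ennreal \<bar>1\<bar> * (\<integral>\<^sup>+\<theta>. G (a + 1 * \<theta>) * indicator {b + a<..<c + a} (a + 1 * \<theta>) \<partial>lborel)"
    by (rule nn_integral_real_affine) auto
  also have "\<dots> = (\<integral>\<^sup>+\<theta>. G (\<theta> + a) * indicator {b<..<c} \<theta> \<partial>lborel)"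
    by (auto simp: indicator_def add.commute intro!: nn_integral_cong)
  finally show ?thesis by simp
qed

text \<open>
The upper and the lower half-plane are the right half-plane turned by \<open>pi/2\<close> and by \<open>3 pi/2\<close>. Using these
two, instead of right and left, gives the angles \<open>(0, pi)\<close> and \<open>(pi, 2 pi)\<close> with no wrap-around.
\<close>

lemma nn_integral_polar:
  fixes F :: "real \<times> real \<Rightarrow> ennreal"
  assumes F[measurable]: "F \<in> borel_measurable borel"
  shows "(\<integral>\<^sup>+p. F p \<partial>lborel) = (\<integral>\<^sup>+p. ennreal (indicator ({0..} \<times> {0..2*pi}) p * fst p)
            * F (fst p * cos (snd p), fst p * sin (snd p)) \<partial>lborel)"
proof -
  define G where "G = (\<lambda>\<theta>. \<integral>\<^sup>+r. F (r * cos \<theta>, r * sin \<theta>) * ennreal r * indicator {0<..} r \<partial>lborel)"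
  have F'[measurable]: "F \<in> borel_measurable (borel \<Otimes>\<^sub>M borel)" using F by (simp add: borel_prod)
  have G[measurable]: "G \<in> borel_measurable borel" unfolding G_def by measurable
  have "(\<integral>\<^sup>+p. F p \<partial>lborel) = (\<integral>\<^sup>+x. \<integral>\<^sup>+y. F (y, x) \<partial>lborel \<partial>lborel)"
    unfolding lborel_prod[symmetric] by (rule lborel_pair.nn_integral_snd[symmetric]) measurable
  also have "\<dots> = (\<integral>\<^sup>+x. (\<integral>\<^sup>+y. F (y, x) * indicator {0<..} x \<partial>lborel) + (\<integral>\<^sup>+y. F (y, x) * indicator {..<0} x \<partial>lborel) \<partial>lborel)"
  proof (rule nn_integral_cong_AE)
    show "AE x in lborel. (\<integral>\<^sup>+y. F (y, x) \<partial>lborel)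
        = (\<integral>\<^sup>+y. F (y, x) * indicator {0<..} x \<partial>lborel) + (\<integral>\<^sup>+y. F (y, x) * indicator {..<0} x \<partial>lborel)"
      using AE_lborel_singleton[of "0::real"]
    proof eventually_elim
      fix x :: real assume "x \<noteq> 0"
      then show "(\<integral>\<^sup>+y. F (y, x) \<partial>lborel)
        = (\<integral>\<^sup>+y. F (y, x) * indicator {0<..} x \<partial>lborel) + (\<integral>\<^sup>+y. F (y, x) * indicator {..<0} x \<partial>lborel)"
        by (cases "x > 0") auto
    qed
  qed
  also have "\<dots> = (\<integral>\<^sup>+x. \<integral>\<^sup>+y. F (y, x) * indicator {0<..} x \<partial>lborel \<partial>lborel)
      + (\<integral>\<^sup>+x. \<integral>\<^sup>+y. F (y, x) * indicator {..<0} x \<partial>lborel \<partial>lborel)"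
    by (rule nn_integral_add) measurable
  also have "(\<integral>\<^sup>+x. \<integral>\<^sup>+y. F (y, x) * indicator {0<..} x \<partial>lborel \<partial>lborel)
      = (\<integral>\<^sup>+x. \<integral>\<^sup>+y. F (- y, x) * indicator {0<..} x \<partial>lborel \<partial>lborel)"
  proof (rule nn_integral_cong)
    fix x :: real
    have "(\<integral>\<^sup>+y. F (y, x) * indicator {0<..} x \<partial>lborel)
       = ennreal \<bar>-1\<bar> * (\<integral>\<^sup>+y. F (0 + (-1) * y, x) * indicator {0<..} x \<partial>lborel)"
      by (rule nn_integral_real_affine) auto
    then show "(\<integral>\<^sup>+y. F (y, x) * indicator {0<..} x \<partial>lborel) = (\<integral>\<^sup>+y. F (- y, x) * indicator {0<..} x \<partial>lborel)"
      by simp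
  qed
  also have "\<dots> = (\<integral>\<^sup>+\<theta>. G (\<theta> + pi/2) * indicator {-(pi/2)<..<pi/2} \<theta> \<partial>lborel)"
    using nn_integral_right_half_plane_polar[of "\<lambda>p. F (- snd p, fst p)"]
    by (simp add: G_def cos_add sin_add)
  also have "(\<integral>\<^sup>+x. \<integral>\<^sup>+y. F (y, x) * indicator {..<0} x \<partial>lborel \<partial>lborel)
      = (\<integral>\<^sup>+x. \<integral>\<^sup>+y. F (y, - x) * indicator {0<..} x \<partial>lborel \<partial>lborel)"
  proof -
    have "(\<integral>\<^sup>+x. \<integral>\<^sup>+y. F (y, x) * indicator {..<0} x \<partial>lborel \<partial>lborel)
      = ennreal \<bar>-1\<bar> * (\<integral>\<^sup>+x. \<integral>\<^sup>+y. F (y, 0 + (-1) * x) * indicator {..<0} (0 + (-1) * x) \<partial>lborel \<partial>lborel)"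
      by (rule nn_integral_real_affine) auto
    then show ?thesis by (simp add: indicator_def)
  qed
  also have "\<dots> = (\<integral>\<^sup>+\<theta>. G (\<theta> + 3*pi/2) * indicator {-(pi/2)<..<pi/2} \<theta> \<partial>lborel)"
  proof -
    have "\<theta> + 3*pi/2 = (\<theta> + pi) + pi/2" for \<theta> by simp
    then have "cos (\<theta> + 3*pi/2) = sin \<theta>" "sin (\<theta> + 3*pi/2) = - cos \<theta>" for \<theta>
      by (simp_all only: cos_add sin_add) simp_all
    then show ?thesis
      using nn_integral_right_half_plane_polar[of "\<lambda>p. F (snd p, - fst p)"]
      by (simp add: G_def)
  qed
  also have "(\<integral>\<^sup>+\<theta>. G (\<theta> + pi/2) * indicator {-(pi/2)<..<pi/2} \<theta> \<partial>lborel)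
       + (\<integral>\<^sup>+\<theta>. G (\<theta> + 3*pi/2) * indicator {-(pi/2)<..<pi/2} \<theta> \<partial>lborel)
       = (\<integral>\<^sup>+\<theta>. G \<theta> * indicator {0<..<pi} \<theta> \<partial>lborel) + (\<integral>\<^sup>+\<theta>. G \<theta> * indicator {pi<..<2*pi} \<theta> \<partial>lborel)"
    unfolding nn_integral_shift_indicator[OF G] by (simp add: field_simps)
  also have "\<dots> = (\<integral>\<^sup>+\<theta>. G \<theta> * indicator {0<..<pi} \<theta> + G \<theta> * indicator {pi<..<2*pi} \<theta> \<partial>lborel)"
    by (rule nn_integral_add[symmetric]) measurable
  also have "\<dots> = (\<integral>\<^sup>+\<theta>. G \<theta> * indicator {0..2*pi} \<theta> \<partial>lborel)"
  proof (rule nn_integral_cong_AE)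
    show "AE \<theta> in lborel. G \<theta> * indicator {0<..<pi} \<theta> + G \<theta> * indicator {pi<..<2*pi} \<theta> = G \<theta> * indicator {0..2*pi} \<theta>"
      using AE_lborel_singleton[of "0::real"] AE_lborel_singleton[of pi] AE_lborel_singleton[of "2*pi"]
    proof eventually_elim
      fix \<theta> :: real assume *: "\<theta> \<noteq> 0" "\<theta> \<noteq> pi" "\<theta> \<noteq> 2 * pi"
      consider "\<theta> < 0" | "0 < \<theta> \<and> \<theta> < pi" | "pi < \<theta> \<and> \<theta> < 2*pi" | "\<theta> > 2 * pi" using * by linarith
      then show "G \<theta> * indicator {0<..<pi} \<theta> + G \<theta> * indicator {pi<..<2*pi} \<theta> = G \<theta> * indicator {0..2*pi} \<theta>"
        by cases (simp_all add: indicator_def)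
    qed
  qed
  also have "\<dots> = (\<integral>\<^sup>+\<theta>. \<integral>\<^sup>+r. ennreal (indicator ({0..} \<times> {0..2*pi}) (r, \<theta>) * r)
            * F (r * cos \<theta>, r * sin \<theta>) \<partial>lborel \<partial>lborel)"
  proof (rule nn_integral_cong)
    fix \<theta> :: real
    have "G \<theta> * indicator {0..2*pi} \<theta> = (\<integral>\<^sup>+r. F (r * cos \<theta>, r * sin \<theta>) * ennreal r * indicator {0<..} r * indicator {0..2*pi} \<theta> \<partial>lborel)"
      unfolding G_def by (rule nn_integral_multc[symmetric]) measurable
    also have "\<dots> = (\<integral>\<^sup>+r. ennreal (indicator ({0..} \<times> {0..2*pi}) (r, \<theta>) * r) * F (r * cos \<theta>, r * sin \<theta>) \<partial>lborel)"
      by (rule nn_integral_cong) (auto simp: indicator_def mult_ac)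
    finally show "G \<theta> * indicator {0..2*pi} \<theta> = \<dots>" .
  qed
  also have "\<dots> = (\<integral>\<^sup>+p. ennreal (indicator ({0..} \<times> {0..2*pi}) p * fst p)
            * F (fst p * cos (snd p), fst p * sin (snd p)) \<partial>lborel)"
    unfolding lborel_prod[symmetric]
    by (subst lborel_pair.nn_integral_snd[symmetric]) (auto simp: case_prod_unfold)
  finally show ?thesis .
qed

lemma lborel_eq_distr_polar:
  "lborel = distr (density lborel (\<lambda>p. ennreal (indicator ({0..} \<times> {0..2*pi}) p * fst p))) borel
      (\<lambda>p :: real \<times> real. (fst p * cos (snd p), fst p * sin (snd p)))" (is "_ = distr ?D borel ?g")
proof (rule measure_eqI)
  have [measurable]: "?g \<in> borel_measurable borel"
    by (intro borel_measurable_continuous_onI continuous_intros)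
  have [measurable]: "(\<lambda>p. ennreal (indicator ({0..} \<times> {0..2*pi}) p * fst p)) \<in> borel_measurable (borel :: (real \<times> real) measure)"
    unfolding borel_prod[symmetric] by measurable
  fix A :: "(real \<times> real) set" assume "A \<in> sets lborel"
  then have [measurable]: "A \<in> sets borel" by simp
  have "emeasure lborel A = (\<integral>\<^sup>+p. indicator A p \<partial>lborel)" by simp
  also have "\<dots> = (\<integral>\<^sup>+p. ennreal (indicator ({0..} \<times> {0..2*pi}) p * fst p) * indicator A (?g p) \<partial>lborel)"
    by (rule nn_integral_polar) measurable
  also have "\<dots> = (\<integral>\<^sup>+p. indicator A (?g p) \<partial>?D)"
    by (rule nn_integral_density[symmetric]) measurable
  also have "\<dots> = (\<integral>\<^sup>+p. indicator A p \<partial>distr ?D borel ?g)"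
    by (rule nn_integral_distr[symmetric]) measurable
  also have "\<dots> = emeasure (distr ?D borel ?g) A" by simp
  finally show "emeasure lborel A = emeasure (distr ?D borel ?g) A" .
qed simp

lemma polar_integrable:
  fixes f :: "real \<times> real \<Rightarrow> complex"
  assumes f: "integrable lborel f"
  shows "integrable lborel (\<lambda>p. (indicator ({0..} \<times> {0..2*pi}) p * fst p) *\<^sub>R f (fst p * cos (snd p), fst p * sin (snd p)))" (is ?th1)
    and "integral\<^sup>L lborel f = (\<integral>p. (indicator ({0..} \<times> {0..2*pi}) p * fst p) *\<^sub>R f (fst p * cos (snd p), fst p * sin (snd p)) \<partial>lborel)" (is ?th2)
proof -
  let ?g = "\<lambda>p :: real \<times> real. (fst p * cos (snd p), fst p * sin (snd p))"
  let ?D = "density lborel (\<lambda>p. ennreal (indicator ({0..} \<times> {0..2*pi}) p * fst p)) :: (real \<times> real) measure"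
  have g[measurable]: "?g \<in> borel_measurable borel"
    by (intro borel_measurable_continuous_onI continuous_intros)
  have [measurable]: "(\<lambda>p. indicator ({0..} \<times> {0..2*pi}) p * fst p) \<in> borel_measurable (borel :: (real \<times> real) measure)"
    unfolding borel_prod[symmetric] by measurable
  have [measurable]: "f \<in> borel_measurable borel" using f by auto
  have nn: "AE p in (lborel :: (real \<times> real) measure). 0 \<le> indicator ({0..} \<times> {0..2*pi}) p * fst p"
    by (intro AE_I2) (auto simp: indicator_def)
  have "integrable (distr ?D borel ?g) f"
    using f by (subst lborel_eq_distr_polar[symmetric])
  then have "integrable ?D (\<lambda>p. f (?g p))"
    by (subst (asm) integrable_distr_eq) auto
  then show ?th1
    by (subst (asm) integrable_density) (use nn in auto)
  have "integral\<^sup>L lborel f = integral\<^sup>L (distr ?D borel ?g) f"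
    by (subst lborel_eq_distr_polar) (rule refl)
  also have "\<dots> = (\<integral>p. f (?g p) \<partial>?D)"
    by (rule integral_distr) auto
  also have "\<dots> = (\<integral>p. (indicator ({0..} \<times> {0..2*pi}) p * fst p) *\<^sub>R f (?g p) \<partial>lborel)"
    by (rule integral_density) (use nn in auto)
  finally show ?th2 .
qed

lemma integral_polar:
  fixes f :: "real \<times> real \<Rightarrow> complex"
  assumes f: "integrable lborel f"
  shows "integral\<^sup>L lborel f = (LBINT r:{0..}. of_real r * (LBINT \<theta>:{0..2*pi}. f (r * cos \<theta>, r * sin \<theta>)))" (is ?th1)
    and "integral\<^sup>L lborel f = (LBINT \<theta>:{0..2*pi}. (LBINT r:{0..}. of_real r * f (r * cos \<theta>, r * sin \<theta>)))" (is ?th2)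
proof -
  define k where "k = (\<lambda>r \<theta>. (indicator ({0..} \<times> {0..2*pi}) (r, \<theta>) * r) *\<^sub>R f (r * cos \<theta>, r * sin \<theta>))"
  have int: "integrable (lborel \<Otimes>\<^sub>M lborel) (\<lambda>(r, \<theta>). k r \<theta>)"
    using polar_integrable(1)[OF f] by (simp add: lborel_prod k_def case_prod_unfold)
  have eq: "integral\<^sup>L lborel f = integral\<^sup>L (lborel \<Otimes>\<^sub>M lborel) (\<lambda>(r, \<theta>). k r \<theta>)"
    using polar_integrable(2)[OF f] by (simp add: lborel_prod k_def case_prod_unfold)
  have "integral\<^sup>L lborel f = (\<integral>r. (\<integral>\<theta>. k r \<theta> \<partial>lborel) \<partial>lborel)"
    unfolding eq by (rule lborel_pair.integral_fst'[symmetric, OF int, simplified])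
  also have "\<dots> = (\<integral>r. indicator {0..} r *\<^sub>R (of_real r * (\<integral>\<theta>. indicator {0..2*pi} \<theta> *\<^sub>R f (r * cos \<theta>, r * sin \<theta>) \<partial>lborel)) \<partial>lborel)"
  proof (rule Bochner_Integration.integral_cong[OF refl])
    fix r :: real
    have "k r \<theta> = (indicator {0..} r * of_real r) * (indicator {0..2*pi} \<theta> *\<^sub>R f (r * cos \<theta>, r * sin \<theta>))" for \<theta>
      by (auto simp: k_def indicator_def scaleR_conv_of_real)
    then show "(\<integral>\<theta>. k r \<theta> \<partial>lborel) = indicator {0..} r *\<^sub>R (of_real r * (\<integral>\<theta>. indicator {0..2*pi} \<theta> *\<^sub>R f (r * cos \<theta>, r * sin \<theta>) \<partial>lborel))"
      by (simp only: integral_mult_right_zero) (simp add: indicator_def)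
  qed
  finally show ?th1 by (simp add: set_lebesgue_integral_def)
  have "integral\<^sup>L lborel f = (\<integral>\<theta>. (\<integral>r. k r \<theta> \<partial>lborel) \<partial>lborel)"
    unfolding eq by (rule lborel_pair.integral_snd[symmetric, OF int])
  also have "\<dots> = (\<integral>\<theta>. indicator {0..2*pi} \<theta> *\<^sub>R (\<integral>r. indicator {0..} r *\<^sub>R (of_real r * f (r * cos \<theta>, r * sin \<theta>)) \<partial>lborel) \<partial>lborel)"
  proof (rule Bochner_Integration.integral_cong[OF refl])
    fix \<theta> :: real
    have "k r \<theta> = indicator {0..2*pi} \<theta> * (indicator {0..} r *\<^sub>R (of_real r * f (r * cos \<theta>, r * sin \<theta>)))" for r
      by (auto simp: k_def indicator_def scaleR_conv_of_real)
    then show "(\<integral>r. k r \<theta> \<partial>lborel) = indicator {0..2*pi} \<theta> *\<^sub>R (\<integral>r. indicator {0..} r *\<^sub>R (of_real r * f (r * cos \<theta>, r * sin \<theta>)) \<partial>lborel)"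
      by (simp only: integral_mult_right_zero) (simp add: indicator_def)
  qed
  finally show ?th2 by (simp add: set_lebesgue_integral_def)
qed

section \<open>Functions of exponential type on horizontal lines\<close>

text \<open>
Cauchy's formula at \<open>w = b + \<i> y2\<close> on the rectangle of width \<open>b\<close> with top side on the line \<open>Im z = y1\<close> and
bottom side at depth \<open>b/2\<close> below \<open>w\<close>, applied to \<open>h\<close> times a weight that is \<open>1\<close> at \<open>w\<close>. On the top side,
where \<open>|h| \<le> e\<close>, the weighted Cauchy kernel is dominated by a multiple of \<open>1 / (1 + (x - b)\<^sup>2)\<close>, whose
integral is at most \<open>pi\<close> independently of \<open>b\<close>. On the other sides the exponent \<open>A\<close> in the weight
cancels the exponential growth of \<open>h\<close>, and the power \<open>N + 2\<close> beats its polynomial growth.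
\<close>

lemma Cauchy_estimate_below_line:
  fixes h :: "complex \<Rightarrow> complex" and A C y1 y2 b e :: real and N :: nat
  assumes h: "h holomorphic_on UNIV" and A: "A \<ge> 0" and C: "C \<ge> 0"
    and growth: "\<And>z. norm (h z) \<le> C * (1 + norm z) ^ N * exp (A * \<bar>Im z\<bar>)"
    and y: "y2 < y1" and b: "b \<ge> 1" and e: "\<And>x. x \<ge> b / 2 \<Longrightarrow> norm (h (Complex x y1)) \<le> e"
  defines "d \<equiv> y1 - y2"
  shows "2 * pi * norm (h (Complex b y2)) \<le>
     e * exp (A * d) * (d + 1) ^ (N + 2) / d * pi
     + C * (3 + \<bar>y1\<bar> + \<bar>y2\<bar>) ^ N * exp (A * (y1 + \<bar>y1\<bar> - y2)) * (2 * (d + 1)) ^ (N + 2) * 2 * (2 + 2 * d) / b"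
proof -
  define w where "w = Complex b y2"
  define c where "c = d + 1"
  define m where "m = N + 2"
  define ph where "ph = (\<lambda>z. h z * exp (- \<i> * of_real A * (z - w)) * (- (\<i> * of_real c) / (z - w - \<i> * of_real c)) ^ m)"
  \<comment> \<open>The pole of the weight is \<open>1\<close> above the line \<open>Im z = y1\<close>, so the half-plane \<open>S\<close> contains the rectangle but not the pole.\<close>
  define S where "S = {z. Im z < y2 + c}"
  have d: "d > 0" using y by (simp add: d_def)
  then have c: "c > 0" by (simp add: c_def)
  have phw: "ph w = h w" using c by (simp add: ph_def)
  define a1 where "a1 = Complex (b/2) (y2 - b/2)"
  define a2 where "a2 = Complex (3*b/2) (y2 - b/2)"
  define a3 where "a3 = Complex (3*b/2) y1"
  define a4 where "a4 = Complex (b/2) y1"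
  have rect: "rectpath a1 a3 = linepath a1 a2 +++ linepath a2 a3 +++ linepath a3 a4 +++ linepath a4 a1"
    by (simp add: rectpath_def Let_def a1_def a2_def a3_def a4_def)
  have wbox: "w \<in> box a1 a3"
    using b y by (simp add: in_box_complex_iff w_def a1_def a3_def)
  have pathS: "path_image (rectpath a1 a3) \<subseteq> S - {w}"
  proof -
    have "path_image (rectpath a1 a3) \<subseteq> cbox a1 a3"
      using b y by (intro path_image_rectpath_subset_cbox) (auto simp: a1_def a3_def)
    moreover have "cbox a1 a3 \<subseteq> S"
      by (auto simp: in_cbox_complex_iff S_def a3_def c_def d_def)
    moreover have "w \<notin> path_image (rectpath a1 a3)"
      using wbox b y by (subst path_image_rectpath_cbox_minus_box) (auto simp: a1_def a3_def)
    ultimately show ?thesis by blast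
  qed
  have Sopen: "open S" unfolding S_def by (rule open_halfspace_Im_lt)
  have phS: "ph holomorphic_on S"
  proof -
    have "z - w - \<i> * of_real c \<noteq> 0" if "z \<in> S" for z
      using that by (auto simp: S_def w_def complex_eq_iff)
    then show ?thesis
      unfolding ph_def by (intro holomorphic_intros holomorphic_on_subset[OF h]) auto
  qed
  have CI: "((\<lambda>z. ph z / (z - w)) has_contour_integral (2 * pi * \<i> * winding_number (rectpath a1 a3) w * ph w)) (rectpath a1 a3)"
  proof (rule Cauchy_integral_formula_convex_simple[OF _ phS])
    show "convex S" unfolding S_def by (rule convex_halfspace_Im_lt)
    show "w \<in> interior S" using Sopen c by (simp add: interior_open S_def w_def)
  qed (use pathS in auto)
  define q where "q = (\<lambda>z. ph z / (z - w))"
  have qc: "continuous_on (S - {w}) q"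
    unfolding q_def by (intro continuous_intros continuous_on_subset[OF holomorphic_on_imp_continuous_on[OF phS]]) auto
  have seg: "closed_segment a1 a2 \<subseteq> S - {w}" "closed_segment a2 a3 \<subseteq> S - {w}"
    "closed_segment a3 a4 \<subseteq> S - {w}" "closed_segment a4 a1 \<subseteq> S - {w}"
    using pathS by (auto simp: rect path_image_join)
  have qi: "q contour_integrable_on linepath a1 a2" "q contour_integrable_on linepath a2 a3"
    "q contour_integrable_on linepath a3 a4" "q contour_integrable_on linepath a4 a1"
    by (intro contour_integrable_continuous_linepath continuous_on_subset[OF qc] seg)+
  have sum: "2 * pi * \<i> * h w = contour_integral (linepath a1 a2) q + (contour_integral (linepath a2 a3) q
      + (contour_integral (linepath a3 a4) q + contour_integral (linepath a4 a1) q))"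
  proof -
    have "contour_integral (rectpath a1 a3) q = 2 * pi * \<i> * h w"
      using CI winding_number_rectpath[OF wbox] phw unfolding q_def by (simp add: contour_integral_unique)
    then show ?thesis using qi by (simp add: rect contour_integrable_joinI)
  qed
  define B where "B = C * (3 + \<bar>y1\<bar> + \<bar>y2\<bar>) ^ N * exp (A * (y1 + \<bar>y1\<bar> - y2)) * (2 * c) ^ m * 2 / b\<^sup>2"
  have B0: "B \<ge> 0" using C c unfolding B_def by simp
  have far: "norm (q z) \<le> B" if z: "z \<in> cbox a1 a3" and zw: "norm (z - w) \<ge> b / 2" and zwc: "norm (z - w - \<i> * of_real c) \<ge> b / 2" for z
  proof -
    have zb: "b/2 \<le> Re z" "Re z \<le> 3*b/2" "y2 - b/2 \<le> Im z" "Im z \<le> y1"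
      using z by (auto simp: in_cbox_complex_iff a1_def a3_def)
    have "norm z \<le> \<bar>Re z\<bar> + \<bar>Im z\<bar>" by (rule cmod_le)
    also have "\<dots> \<le> 3*b/2 + (b/2 + \<bar>y1\<bar> + \<bar>y2\<bar>)" using zb b by (intro add_mono) auto
    finally have "1 + norm z \<le> b * 3 + 1 * (\<bar>y1\<bar> + \<bar>y2\<bar>)" using b by simp
    also have "\<dots> \<le> b * 3 + b * (\<bar>y1\<bar> + \<bar>y2\<bar>)" using b by (intro add_mono mult_right_mono) auto
    finally have n1: "1 + norm z \<le> b * (3 + \<bar>y1\<bar> + \<bar>y2\<bar>)" by (simp add: algebra_simps)
    have "norm (h z) * exp (A * (Im z - y2)) \<le> C * (1 + norm z) ^ N * exp (A * \<bar>Im z\<bar>) * exp (A * (Im z - y2))"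
      by (intro mult_right_mono growth) auto
    also have "\<dots> = C * (1 + norm z) ^ N * exp (A * (\<bar>Im z\<bar> + (Im z - y2)))"
      by (simp add: distrib_left exp_add mult.assoc)
    also have "\<dots> \<le> C * (b * (3 + \<bar>y1\<bar> + \<bar>y2\<bar>)) ^ N * exp (A * (y1 + \<bar>y1\<bar> - y2))"
    proof -
      \<comment> \<open>In the lower half-plane the two exponents cancel; between the real axis and \<open>y1\<close> they are bounded.\<close>
      have "\<bar>Im z\<bar> + (Im z - y2) \<le> y1 + \<bar>y1\<bar> - y2" using zb by auto
      then show ?thesis using n1 A C b by (intro mult_mono power_mono) (auto simp: mult_left_mono)
    qed
    finally have 1: "norm (h z) * exp (A * (Im z - y2)) \<le> C * (b * (3 + \<bar>y1\<bar> + \<bar>y2\<bar>)) ^ N * exp (A * (y1 + \<bar>y1\<bar> - y2))" .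
    have 2: "(c / norm (z - w - \<i> * of_real c)) ^ m \<le> (c / (b/2)) ^ m"
      using zwc b c by (intro power_mono frac_le) auto
    have "norm (q z) = (norm (h z) * exp (A * (Im z - y2))) * (c / norm (z - w - \<i> * of_real c)) ^ m / norm (z - w)"
      using c by (simp add: q_def ph_def norm_divide norm_mult norm_power w_def)
    also have "\<dots> \<le> (C * (b * (3 + \<bar>y1\<bar> + \<bar>y2\<bar>)) ^ N * exp (A * (y1 + \<bar>y1\<bar> - y2))) * (c / (b/2)) ^ m / (b/2)"
      using b c C zw by (intro frac_le mult_mono 1 2) auto
    also have "\<dots> = B / b"
    proof -
      have "(b * Y) ^ N * ((c / (b/2)) ^ m / (b/2)) = Y ^ N * ((2 * c) ^ m * 2 / b\<^sup>2 / b)" for Y :: real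
        using b by (simp add: m_def power_mult_distrib power_divide power2_eq_square power_add mult_ac)
      then have "C * (b * Y) ^ N * E * (c / (b/2)) ^ m / (b/2) = C * Y ^ N * E * (2 * c) ^ m * 2 / b\<^sup>2 / b" for Y E :: real
      proof -
        have "C * (b * Y) ^ N * E * (c / (b/2)) ^ m / (b/2) = (C * E) * ((b * Y) ^ N * ((c / (b/2)) ^ m / (b/2)))"
          by (simp only: times_divide_eq_right mult_ac)
        also have "\<dots> = (C * E) * (Y ^ N * ((2 * c) ^ m * 2 / b\<^sup>2 / b))"
          by (simp only: \<open>\<And>Y. (b * Y) ^ N * ((c / (b/2)) ^ m / (b/2)) = Y ^ N * ((2 * c) ^ m * 2 / b\<^sup>2 / b)\<close>)
        also have "\<dots> = C * Y ^ N * E * (2 * c) ^ m * 2 / b\<^sup>2 / b"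
          by (simp only: times_divide_eq_right mult_ac)
        finally show ?thesis .
      qed
      then show ?thesis unfolding B_def .
    qed
    also have "\<dots> \<le> B" using b B0 by (simp add: divide_le_eq mult_le_cancel_left1)
    finally show ?thesis .
  qed
  have i1: "norm (contour_integral (linepath a1 a2) q) \<le> B * b"
  proof -
    have "norm (contour_integral (linepath a1 a2) q) \<le> B * norm (a2 - a1)"
    proof (rule contour_integral_bound_linepath[OF qi(1) B0 far])
      fix z assume z: "z \<in> closed_segment a1 a2"
      then have zI: "Im z = y2 - b/2" "b/2 \<le> Re z" "Re z \<le> 3*b/2"
        using b by (auto simp: a1_def a2_def closed_segment_same_Im closed_segment_eq_real_ivl)
      then show "z \<in> cbox a1 a3" using b y by (auto simp: in_cbox_complex_iff a1_def a3_def)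
      show "b / 2 \<le> norm (z - w)"
        using abs_Im_le_cmod[of "z - w"] b zI by (auto simp: w_def)
      show "b / 2 \<le> norm (z - w - \<i> * of_real c)"
        using abs_Im_le_cmod[of "z - w - \<i> * of_real c"] b zI c by (auto simp: w_def)
    qed
    moreover have "a2 - a1 = of_real b" by (simp add: a1_def a2_def complex_eq_iff)
    ultimately show ?thesis using b by simp
  qed
  have side: "norm (contour_integral (linepath u v) q) \<le> B * (b/2 + d)"
    if uv: "(u = a2 \<and> v = a3) \<or> (u = a4 \<and> v = a1)" for u v
  proof -
    have "norm (contour_integral (linepath u v) q) \<le> B * norm (v - u)"
    proof (rule contour_integral_bound_linepath[OF _ B0 far])
      show "q contour_integrable_on linepath u v" using qi uv by auto
      fix z assume z: "z \<in> closed_segment u v"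
      then have zI: "\<bar>Re z - b\<bar> = b/2" "y2 - b/2 \<le> Im z" "Im z \<le> y1"
        using b y uv by (auto simp: a1_def a2_def a3_def a4_def closed_segment_same_Re closed_segment_eq_real_ivl split: if_splits)
      have zR: "b/2 \<le> Re z" "Re z \<le> 3*b/2" using zI(1) b by linarith+
      show "z \<in> cbox a1 a3" using zI zR by (auto simp: in_cbox_complex_iff a1_def a3_def)
      show "b / 2 \<le> norm (z - w)"
        using abs_Re_le_cmod[of "z - w"] b zI by (auto simp: w_def)
      show "b / 2 \<le> norm (z - w - \<i> * of_real c)"
        using abs_Re_le_cmod[of "z - w - \<i> * of_real c"] b zI c by (auto simp: w_def)
    qed
    moreover have "norm (v - u) = b/2 + d"
    proof -
      have "v - u = \<i> * of_real (b/2 + d) \<or> v - u = - (\<i> * of_real (b/2 + d))"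
        using uv by (auto simp: a1_def a2_def a3_def a4_def complex_eq_iff d_def)
      then have "norm (v - u) = \<bar>b/2 + d\<bar>"
      proof
        assume "v - u = - (\<i> * of_real (b/2 + d))"
        then show ?thesis by (simp only: norm_minus_cancel norm_mult norm_ii norm_of_real mult_1)
      qed (simp only: norm_mult norm_ii norm_of_real mult_1)
      then show ?thesis using b d by simp
    qed
    ultimately show ?thesis by simp
  qed
  have e0: "e \<ge> 0" by (rule order_trans[OF norm_ge_zero e[of b]]) (use b in auto)
  define K where "K = e * exp (A * d) * c ^ m / d"
  have K0: "K \<ge> 0" using e0 c d by (simp add: K_def)
  have top: "norm (contour_integral (linepath a3 a4) q) \<le> K * pi"
  proof -
    have qI: "(q has_contour_integral contour_integral (linepath a4 a3) q) (linepath a4 a3)"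
    proof (rule has_contour_integral_integral)
      show "q contour_integrable_on linepath a4 a3"
        using seg(3) by (intro contour_integrable_continuous_linepath continuous_on_subset[OF qc])
          (simp add: closed_segment_commute)
    qed
    have hi: "((\<lambda>x. q (of_real x + Im a4 * \<i>)) has_integral contour_integral (linepath a4 a3) q) {b/2..3*b/2}"
    proof -
      have eq: "linepath a4 a3 t = linepath (of_real (b/2)) (of_real (3*b/2)) t + Im a4 * \<i>"
        "a3 - a4 = of_real (3*b/2) - of_real (b/2)" for t
        by (simp_all add: linepath_def a3_def a4_def complex_eq_iff algebra_simps)
      from qI have "((\<lambda>z. q (z + Im a4 * \<i>)) has_contour_integral contour_integral (linepath a4 a3) q)
          (linepath (of_real (b/2)) (of_real (3*b/2)))"
        unfolding has_contour_integral_linepath eq .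
      then show ?thesis
        using b by (subst (asm) has_contour_integral_linepath_Reals_iff) auto
    qed
    have at: "((\<lambda>x. K * (1 / (1 + (x - b)\<^sup>2))) has_integral K * (arctan (3*b/2 - b) - arctan (b/2 - b))) {b/2..3*b/2}"
    proof (intro has_integral_mult_right fundamental_theorem_of_calculus)
      fix x :: real
      have "((\<lambda>x. arctan (x - b)) has_real_derivative 1 / (1 + (x - b)\<^sup>2)) (at x)"
        using DERIV_chain2[OF DERIV_arctan DERIV_diff[OF DERIV_ident DERIV_const]] by (simp add: divide_inverse)
      then have "((\<lambda>x. arctan (x - b)) has_real_derivative 1 / (1 + (x - b)\<^sup>2)) (at x within {b/2..3*b/2})"
        by (rule has_field_derivative_at_within)
      then show "((\<lambda>x. arctan (x - b)) has_vector_derivative 1 / (1 + (x - b)\<^sup>2)) (at x within {b/2..3*b/2})"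
        by (simp only: has_real_derivative_iff_has_vector_derivative)
    qed (use b in simp)
    have "norm (integral {b/2..3*b/2} (\<lambda>x. q (of_real x + Im a4 * \<i>)))
        \<le> integral {b/2..3*b/2} (\<lambda>x. K * (1 / (1 + (x - b)\<^sup>2)))"
    proof (rule integral_norm_bound_integral)
      show "(\<lambda>x. q (of_real x + Im a4 * \<i>)) integrable_on {b/2..3*b/2}" using hi by blast
      show "(\<lambda>x. K * (1 / (1 + (x - b)\<^sup>2))) integrable_on {b/2..3*b/2}" using at by blast
      fix x assume x: "x \<in> {b/2..3*b/2}"
      define z where "z = of_real x + Im a4 * \<i>"
      have z: "z = Complex x y1" by (simp add: z_def a4_def complex_eq_iff)
      have n: "norm (z - w - \<i> * of_real c) ^ 2 = 1 + (x - b)\<^sup>2"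
        by (simp add: z w_def cmod_power2 c_def d_def)
      then have n1: "norm (z - w - \<i> * of_real c) \<ge> 1"
        by (intro power2_le_imp_le[of 1]) auto
      have 1: "(c / norm (z - w - \<i> * of_real c)) ^ m \<le> c ^ m / (1 + (x - b)\<^sup>2)"
      proof -
        have "norm (z - w - \<i> * of_real c) ^ 2 \<le> norm (z - w - \<i> * of_real c) ^ m"
          using n1 by (intro power_increasing) (auto simp: m_def)
        then show ?thesis unfolding power_divide n[symmetric]
          using c n1 by (intro frac_le) auto
      qed
      have 2: "d \<le> norm (z - w)" using abs_Im_le_cmod[of "z - w"] by (simp add: z w_def d_def)
      have "norm (q z) = (norm (h z) * exp (A * d)) * (c / norm (z - w - \<i> * of_real c)) ^ m / norm (z - w)"
        using c by (simp add: q_def ph_def norm_divide norm_mult norm_power w_def z d_def)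
      also have "\<dots> \<le> (e * exp (A * d)) * (c ^ m / (1 + (x - b)\<^sup>2)) / d"
        using d c e0 x by (intro frac_le mult_mono 1 2) (auto simp: z intro!: e)
      also have "\<dots> = K * (1 / (1 + (x - b)\<^sup>2))" by (simp add: K_def)
      finally show "norm (q (of_real x + Im a4 * \<i>)) \<le> K * (1 / (1 + (x - b)\<^sup>2))" by (simp add: z_def)
    qed
    then have "norm (contour_integral (linepath a4 a3) q) \<le> K * (arctan (3*b/2 - b) - arctan (b/2 - b))"
      by (simp only: integral_unique[OF hi] integral_unique[OF at])
    also have "\<dots> \<le> K * pi"
      using arctan_ubound[of "3*b/2 - b"] arctan_lbound[of "b/2 - b"] K0 by (intro mult_left_mono) auto
    finally have "norm (contour_integral (linepath a4 a3) q) \<le> K * pi" .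
    moreover have "contour_integral (linepath a3 a4) q = - contour_integral (linepath a4 a3) q"
      by (rule contour_integral_reverse_linepath[OF continuous_on_subset[OF qc seg(3)]])
    ultimately show ?thesis by simp
  qed
  have "2 * pi * norm (h w) = norm (2 * pi * \<i> * h w)" by (simp add: norm_mult)
  also have "\<dots> \<le> B * b + (B * (b/2 + d) + (K * pi + B * (b/2 + d)))"
    unfolding sum by (intro norm_triangle_le add_mono i1 side top) auto
  also have "\<dots> = K * pi + B * (2 * b + 2 * d)" by (simp add: algebra_simps)
  also have "\<dots> \<le> K * pi + B * (b * (2 + 2 * d))"
    using b d B0 by (intro add_left_mono mult_left_mono) (auto simp: algebra_simps)
  also have "B * (b * (2 + 2 * d)) = C * (3 + \<bar>y1\<bar> + \<bar>y2\<bar>) ^ N * exp (A * (y1 + \<bar>y1\<bar> - y2)) * (2 * c) ^ m * 2 * (2 + 2 * d) / b"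
    using b unfolding B_def by (simp add: power2_eq_square)
  finally show ?thesis by (simp add: w_def K_def c_def m_def)
qed

lemma tendsto_horizontal_line_below:
  fixes h :: "complex \<Rightarrow> complex"
  assumes h: "h holomorphic_on UNIV" and A: "A \<ge> 0" and C: "C \<ge> 0"
    and growth: "\<And>z. norm (h z) \<le> C * (1 + norm z) ^ N * exp (A * \<bar>Im z\<bar>)"
    and y: "y2 < y1" and lim: "((\<lambda>x. h (Complex x y1)) \<longlongrightarrow> 0) at_top"
  shows "((\<lambda>x. h (Complex x y2)) \<longlongrightarrow> 0) at_top"
proof -
  define d where "d = y1 - y2"
  have d: "d > 0" using y by (simp add: d_def)
  define K where "K = exp (A * d) * (d + 1) ^ (N + 2) / d * pi"
  define L where "L = C * (3 + \<bar>y1\<bar> + \<bar>y2\<bar>) ^ N * exp (A * (y1 + \<bar>y1\<bar> - y2)) * (2 * (d + 1)) ^ (N + 2) * 2 * (2 + 2 * d)"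
  have K: "K > 0" using d by (simp add: K_def)
  have L: "L \<ge> 0" using d C by (simp add: L_def)
  show ?thesis
  proof (rule tendstoI)
    fix \<epsilon> :: real assume \<epsilon>: "\<epsilon> > 0"
    define e where "e = \<epsilon> / K"
    have "e > 0" using \<epsilon> K by (simp add: e_def)
    with lim have "\<forall>\<^sub>F x in at_top. norm (h (Complex x y1)) < e"
      by (simp add: tendsto_iff)
    then obtain X where X: "\<And>x. x \<ge> X \<Longrightarrow> norm (h (Complex x y1)) < e"
      by (auto simp: eventually_at_top_linorder)
    show "\<forall>\<^sub>F x in at_top. dist (h (Complex x y2)) 0 < \<epsilon>"
      using eventually_ge_at_top[of 1] eventually_ge_at_top[of "2 * X"] eventually_gt_at_top[of "L / \<epsilon>"]
    proof eventually_elim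
      case (elim b)
      have "2 * pi * norm (h (Complex b y2)) \<le> e * K + L / b"
        using Cauchy_estimate_below_line[OF h A C growth y, of b e] elim X
        by (simp add: K_def L_def d_def less_imp_le mult_ac)
      also have "e * K = \<epsilon>" using K by (simp add: e_def)
      also have "L / b < \<epsilon>" using elim \<epsilon> by (simp add: field_simps)
      finally have "2 * pi * norm (h (Complex b y2)) < 2 * \<epsilon>" by simp
      moreover have "2 * norm (h (Complex b y2)) \<le> 2 * pi * norm (h (Complex b y2))"
        using pi_ge_two by (intro mult_right_mono) auto
      ultimately show ?case by simp
    qed
  qed
qed

text \<open>
Lines above the given one are reached by applying the previous lemma to \<open>cnj (h (cnj z))\<close>.
\<close>

lemma tendsto_horizontal_line:
  fixes h :: "complex \<Rightarrow> complex"
  assumes h: "h holomorphic_on UNIV" and A: "A \<ge> 0"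
    and growth: "\<And>z. norm (h z) \<le> C * (1 + norm z) ^ N * exp (A * \<bar>Im z\<bar>)"
    and lim: "((\<lambda>x. h (Complex x y1)) \<longlongrightarrow> I) at_top"
  shows "((\<lambda>x. h (Complex x y2)) \<longlongrightarrow> I) at_top"
proof -
  \<comment> \<open>The constant absorbs the limit \<open>I\<close>, which is subtracted to reduce to the limit \<open>0\<close>.\<close>
  define C' where "C' = \<bar>C\<bar> + norm I"
  define g where "g = (\<lambda>z. h z - I)"
  have C': "C' \<ge> 0" by (simp add: C'_def)
  have g: "g holomorphic_on UNIV" unfolding g_def by (intro holomorphic_intros h)
  have gg: "norm (g z) \<le> C' * (1 + norm z) ^ N * exp (A * \<bar>Im z\<bar>)" for z
  proof -
    have "1 \<le> (1 + norm z) ^ N * exp (A * \<bar>Im z\<bar>)"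
      using mult_mono[of 1 "(1 + norm z) ^ N" 1 "exp (A * \<bar>Im z\<bar>)"] A by simp
    then have "norm I * 1 \<le> norm I * ((1 + norm z) ^ N * exp (A * \<bar>Im z\<bar>))"
      by (intro mult_left_mono) auto
    moreover have "norm (h z) \<le> \<bar>C\<bar> * ((1 + norm z) ^ N * exp (A * \<bar>Im z\<bar>))"
    proof -
      have "C * ((1 + norm z) ^ N * exp (A * \<bar>Im z\<bar>)) \<le> \<bar>C\<bar> * ((1 + norm z) ^ N * exp (A * \<bar>Im z\<bar>))"
        by (intro mult_right_mono) auto
      with growth[of z] show ?thesis by (simp add: mult.assoc)
    qed
    moreover have "norm (g z) \<le> norm (h z) + norm I" unfolding g_def by (rule norm_triangle_ineq4)
    ultimately show ?thesis by (simp add: C'_def algebra_simps)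
  qed
  have limg: "((\<lambda>x. g (Complex x y1)) \<longlongrightarrow> 0) at_top"
    using lim unfolding g_def by (simp add: LIM_zero_iff)
  have "((\<lambda>x. g (Complex x y2)) \<longlongrightarrow> 0) at_top"
  proof (cases y1 y2 rule: linorder_cases)
    case greater
    then show ?thesis using tendsto_horizontal_line_below[OF g A C' gg _ limg] by blast
  next
    case less
    define k where "k = cnj \<circ> g \<circ> cnj"
    have "k holomorphic_on UNIV" unfolding k_def
      by (rule holomorphic_on_compose_cnj_cnj) (auto intro: holomorphic_on_subset[OF g])
    moreover have "norm (k z) \<le> C' * (1 + norm z) ^ N * exp (A * \<bar>Im z\<bar>)" for z
      using gg[of "cnj z"] by (simp add: k_def)
    moreover have "((\<lambda>x. k (Complex x (- y1))) \<longlongrightarrow> 0) at_top"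
      using tendsto_cnj[OF limg] by (simp add: k_def complex_cnj)
    ultimately have "((\<lambda>x. k (Complex x (- y2))) \<longlongrightarrow> 0) at_top"
      using tendsto_horizontal_line_below[of k A C' N "- y2" "- y1"] A C' less by auto
    from tendsto_cnj[OF this] show ?thesis by (simp add: k_def complex_cnj)
  qed (use limg in simp)
  then show ?thesis unfolding g_def by (simp add: LIM_zero_iff)
qed

section \<open>Hankel coefficients as plane integrals\<close>

lemma integrable_mult_bounded:
  fixes f k :: "'a \<Rightarrow> complex"
  assumes f: "integrable M f" and k: "k \<in> borel_measurable M"
    and B: "\<And>x. f x \<noteq> 0 \<Longrightarrow> norm (k x) \<le> B"
  shows "integrable M (\<lambda>x. f x * k x)"
    and "norm (\<integral>x. f x * k x \<partial>M) \<le> B * (\<integral>x. norm (f x) \<partial>M)"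
    and "(\<integral>x. norm (f x * k x) \<partial>M) \<le> B * (\<integral>x. norm (f x) \<partial>M)"
proof -
  have i: "integrable M (\<lambda>x. B * norm (f x))" using f by auto
  have le: "norm (f x * k x) \<le> B * norm (f x)" for x
    using B[of x] by (cases "f x = 0") (auto simp: norm_mult mult.commute[of B] intro: mult_left_mono)
  show int: "integrable M (\<lambda>x. f x * k x)"
  proof (rule Bochner_Integration.integrable_bound[OF i])
    show "(\<lambda>x. f x * k x) \<in> borel_measurable M" using f k by auto
    show "AE x in M. norm (f x * k x) \<le> norm (B * norm (f x))"
      using order_trans[OF le abs_ge_self] by (intro AE_I2) simp
  qed
  have "(\<integral>x. norm (f x * k x) \<partial>M) \<le> (\<integral>x. B * norm (f x) \<partial>M)"
    using i int le by (intro integral_mono) auto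
  then show le': "(\<integral>x. norm (f x * k x) \<partial>M) \<le> B * (\<integral>x. norm (f x) \<partial>M)" by simp
  show "norm (\<integral>x. f x * k x \<partial>M) \<le> B * (\<integral>x. norm (f x) \<partial>M)"
    using integral_norm_bound[of M "\<lambda>x. f x * k x"] le' by linarith
qed

text \<open>
The factor \<open>exp (- \<i> l \<theta>)\<close> as a function of the point with polar angle \<open>\<theta>\<close>, so that angular Fourier
coefficients become integrals over the plane. It is a power of a quotient, and not defined through
the argument, because then its measurability is immediate.
\<close>

definition angular_factor :: "int \<Rightarrow> real \<times> real \<Rightarrow> complex" where
  "angular_factor l y = (Complex (fst y) (- snd y) / of_real (norm y)) powi l"

lemma norm_polar: "norm (r * cos \<theta>, r * sin \<theta>) = \<bar>r :: real\<bar>"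
proof -
  have "(r * cos \<theta>)\<^sup>2 + (r * sin \<theta>)\<^sup>2 = r\<^sup>2 * ((cos \<theta>)\<^sup>2 + (sin \<theta>)\<^sup>2)"
    by (simp only: power_mult_distrib distrib_left)
  then show ?thesis by (simp add: norm_Pair)
qed

lemma angular_factor_polar:
  assumes "r > 0"
  shows "angular_factor l (r * cos \<theta>, r * sin \<theta>) = cis (- (of_int l * \<theta>))"
proof -
  have "Complex (r * cos \<theta>) (- (r * sin \<theta>)) / of_real r = cis (- \<theta>)"
    using assms by (simp add: complex_eq_iff)
  then show ?thesis
    using assms by (simp add: angular_factor_def norm_polar cis_power_int)
qed

lemma borel_measurable_angular_factor [measurable]: "angular_factor l \<in> borel_measurable borel"
proof -
  have "(\<lambda>y :: real \<times> real. Complex (fst y) (- snd y)) = (\<lambda>y. of_real (fst y) - \<i> * of_real (snd y))"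
    by (simp add: fun_eq_iff complex_eq_iff)
  moreover have "(\<lambda>y :: real \<times> real. of_real (fst y) - \<i> * of_real (snd y) :: complex) \<in> borel_measurable borel"
    by (intro borel_measurable_continuous_onI continuous_intros)
  ultimately have [measurable]: "(\<lambda>y :: real \<times> real. Complex (fst y) (- snd y)) \<in> borel_measurable borel" by simp
  show ?thesis unfolding angular_factor_def[abs_def] power_int_def by measurable
qed

lemma norm_angular_factor_le: "norm (angular_factor l y) \<le> 1"
proof (cases "y = 0")
  case False
  have "norm (Complex (fst y) (- snd y)) = norm y"
    by (simp add: norm_prod_def complex_norm)
  with False show ?thesis by (simp add: angular_factor_def norm_power_int norm_divide)
next
  case True
  then show ?thesis by (simp add: angular_factor_def power_int_0_left_if)
qed

lemma borel_measurable_bessel_J [measurable]: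
  "(\<lambda>y :: real \<times> real. bessel_J n (z * of_real (norm y))) \<in> borel_measurable borel"
  by (intro borel_measurable_continuous_onI continuous_intros)

context
  fixes f :: "real \<times> real \<Rightarrow> complex" and R1 :: real
  assumes f: "integrable lborel f" and supp: "\<And>x. norm x > R1 \<Longrightarrow> f x = 0"
begin

lemma norm_bessel_J_on_support:
  "f y \<noteq> 0 \<Longrightarrow> norm (bessel_J n (z * of_real (norm y))) \<le> exp (R1 * \<bar>Im z\<bar>)"
proof -
  assume "f y \<noteq> 0"
  then have y: "norm y \<le> R1" using supp[of y] by (cases "norm y > R1") auto
  have "norm (bessel_J n (z * of_real (norm y))) \<le> exp \<bar>Im (z * of_real (norm y))\<bar>"
    by (rule norm_bessel_J_le)
  also have "\<bar>Im (z * of_real (norm y))\<bar> = norm y * \<bar>Im z\<bar>" by (simp add: abs_mult)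
  also have "exp (norm y * \<bar>Im z\<bar>) \<le> exp (R1 * \<bar>Im z\<bar>)" using y by (simp add: mult_right_mono)
  finally show ?thesis .
qed

lemma hankel_kernel_bound:
  "f y \<noteq> 0 \<Longrightarrow> norm (angular_factor l y * bessel_J n (z * of_real (norm y))) \<le> exp (R1 * \<bar>Im z\<bar>)"
  using mult_mono[OF norm_angular_factor_le[of l y] norm_bessel_J_on_support[of y n z]]
  by (simp add: norm_mult)

lemma integrable_hankel_kernel:
  "integrable lborel (\<lambda>y. f y * (angular_factor l y * bessel_J n (z * of_real (norm y))))"
  by (rule integrable_mult_bounded(1)[OF f _ hankel_kernel_bound]) measurable

text \<open>
Integrating in polar coordinates, the inner integral over the angle is the angular coefficient. In
this form the properties of \<open>F_l\<close> follow from the integrability of \<open>f\<close> over the plane.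
\<close>

lemma hankel_coeff_plane:
  "hankel_coeff f l z = 1 / (2 * of_real pi) *
     (\<integral>y. f y * (angular_factor l y * bessel_J (nat \<bar>l\<bar>) (z * of_real (norm y))) \<partial>lborel)"
proof -
  let ?n = "nat \<bar>l\<bar>"
  have eq: "of_real r * (LBINT \<theta>:{0..2*pi}. f (r * cos \<theta>, r * sin \<theta>) *
      (angular_factor l (r * cos \<theta>, r * sin \<theta>) * bessel_J ?n (z * of_real (norm (r * cos \<theta>, r * sin \<theta>)))))
     = 2 * of_real pi * (of_real r * angular_coeff f l r * bessel_J ?n (z * of_real r))" if "r \<in> {0..}" for r
  proof (cases "r = 0")
    case False
    with that have r: "r > 0" by simp
    have "(LBINT \<theta>:{0..2*pi}. f (r * cos \<theta>, r * sin \<theta>) *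
      (angular_factor l (r * cos \<theta>, r * sin \<theta>) * bessel_J ?n (z * of_real (norm (r * cos \<theta>, r * sin \<theta>)))))
      = (LBINT \<theta>:{0..2*pi}. bessel_J ?n (z * of_real r) * (exp (- (\<i> * of_int l * of_real \<theta>)) * f (r * cos \<theta>, r * sin \<theta>)))"
      using r by (simp add: angular_factor_polar norm_polar cis_conv_exp mult_ac)
    also have "\<dots> = bessel_J ?n (z * of_real r) * (2 * of_real pi * angular_coeff f l r)"
      by (simp add: angular_coeff_def)
    finally show ?thesis by simp
  qed simp
  have "(\<integral>y. f y * (angular_factor l y * bessel_J ?n (z * of_real (norm y))) \<partial>lborel)
     = (LBINT r:{0..}. 2 * of_real pi * (of_real r * angular_coeff f l r * bessel_J ?n (z * of_real r)))"
    unfolding integral_polar(1)[OF integrable_hankel_kernel]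
    by (rule set_lebesgue_integral_cong) (use eq in auto)
  then show ?thesis by (simp add: hankel_coeff_def)
qed

lemma norm_hankel_coeff_le:
  "norm (hankel_coeff f l z) \<le> exp (R1 * \<bar>Im z\<bar>) * (\<integral>y. norm (f y) \<partial>lborel) / (2 * pi)"
proof -
  have "norm (\<integral>y. f y * (angular_factor l y * bessel_J (nat \<bar>l\<bar>) (z * of_real (norm y))) \<partial>lborel)
     \<le> exp (R1 * \<bar>Im z\<bar>) * (\<integral>y. norm (f y) \<partial>lborel)"
    by (rule integrable_mult_bounded(2)[OF f _ hankel_kernel_bound]) measurable
  then show ?thesis by (simp add: hankel_coeff_plane norm_mult norm_divide divide_right_mono)
qed

text \<open>
Expanding the Bessel function under the plane integral gives a power series: on the support of \<open>f\<close>
the \<open>k\<close>-th term is at most \<open>(|w| R1\<^sup>2)^k / k!\<close> times a multiple of \<open>|f|\<close>, so integration and summation may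
be exchanged.
\<close>

lemma holomorphic_hankel_coeff: "hankel_coeff f l holomorphic_on UNIV"
proof -
  let ?n = "nat \<bar>l\<bar>"
  define a where "a = (\<lambda>k. (-1/4) ^ k / (fact k * fact (k + ?n)) :: complex)"
  define m where "m = (\<lambda>k y. f y * (angular_factor l y * of_real (norm y / 2) ^ ?n * (a k * of_real ((norm y)\<^sup>2) ^ k)))"
  define P where "P = (\<lambda>w. \<integral>y. f y * (angular_factor l y * of_real (norm y / 2) ^ ?n * bessel_profile ?n (w * of_real ((norm y)\<^sup>2))) \<partial>lborel)"
  have fy: "norm y \<le> R1" if "f y \<noteq> 0" for y using supp[of y] that by (cases "norm y > R1") auto
  have bnd: "norm (angular_factor l y * of_real (norm y / 2) ^ ?n * (a k * of_real ((norm y)\<^sup>2) ^ k) * w ^ k)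
      \<le> (R1 / 2) ^ ?n * (norm (w * of_real (R1\<^sup>2)) ^ k / fact k)" if y: "f y \<noteq> 0" for k y w
  proof -
    have R: "norm y \<le> R1" by (rule fy[OF y])
    then have R0: "0 \<le> R1" using norm_ge_zero order_trans by blast
    have 1: "norm (a k * of_real ((norm y)\<^sup>2) ^ k * w ^ k) \<le> norm (w * of_real (R1\<^sup>2)) ^ k / fact k"
    proof -
      have "norm (a k * of_real ((norm y)\<^sup>2) ^ k * w ^ k) = norm (a k * (w * of_real ((norm y)\<^sup>2)) ^ k)"
        by (simp add: power_mult_distrib mult_ac)
      also have "\<dots> \<le> norm (w * of_real ((norm y)\<^sup>2)) ^ k / fact k"
        unfolding a_def by (rule norm_bessel_profile_term_le)
      also have "\<dots> \<le> norm (w * of_real (R1\<^sup>2)) ^ k / fact k"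
        using R R0 by (intro divide_right_mono power_mono) (auto simp: norm_mult norm_power intro!: mult_left_mono power_mono)
      finally show ?thesis .
    qed
    have 2: "norm (angular_factor l y * of_real (norm y / 2) ^ ?n) \<le> 1 * (R1 / 2) ^ ?n"
      unfolding norm_mult norm_power using R
      by (intro mult_mono norm_angular_factor_le power_mono) auto
    have "norm (angular_factor l y * of_real (norm y / 2) ^ ?n * (a k * of_real ((norm y)\<^sup>2) ^ k * w ^ k))
      \<le> (1 * (R1 / 2) ^ ?n) * (norm (w * of_real (R1\<^sup>2)) ^ k / fact k)"
      unfolding norm_mult[of "angular_factor l y * of_real (norm y / 2) ^ ?n"]
      using R0 by (intro mult_mono 1 2) auto
    then show ?thesis by (simp add: mult.assoc)
  qed
  have S: "(\<lambda>k. (\<integral>y. m k y \<partial>lborel) * w ^ k) sums P w" for w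
  proof -
    define g where "g = (\<lambda>k y. f y * (angular_factor l y * of_real (norm y / 2) ^ ?n * (a k * of_real ((norm y)\<^sup>2) ^ k) * w ^ k))"
    have gm: "g k y = m k y * w ^ k" for k y by (simp add: g_def m_def)
    have [measurable]: "(\<lambda>y. angular_factor l y * of_real (norm y / 2) ^ ?n * (a k * of_real ((norm y)\<^sup>2) ^ k) * w ^ k) \<in> borel_measurable lborel" for k
      by measurable
    have sumE: "summable (\<lambda>k. norm (w * of_real (R1\<^sup>2)) ^ k / fact k)"
      using summable_exp_generic[of "norm (w * of_real (R1\<^sup>2))"] by (simp add: field_simps)
    have int: "integrable lborel (g k)" for k
      unfolding g_def by (rule integrable_mult_bounded(1)[OF f _ bnd]) measurable
    have sumf: "(\<lambda>k. g k y) sums (f y * (angular_factor l y * of_real (norm y / 2) ^ ?n * bessel_profile ?n (w * of_real ((norm y)\<^sup>2))))" for y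
      using sums_mult[OF bessel_profile_sums[of ?n "w * of_real ((norm y)\<^sup>2)"], of "f y * (angular_factor l y * of_real (norm y / 2) ^ ?n)"]
      by (simp add: g_def a_def power_mult_distrib mult_ac)
    have "(\<lambda>k. integral\<^sup>L lborel (g k)) sums (\<integral>y. (\<Sum>k. g k y) \<partial>lborel)"
    proof (rule sums_integral[OF int])
      show "AE y in lborel. summable (\<lambda>k. norm (g k y))"
      proof (rule AE_I2)
        fix y
        show "summable (\<lambda>k. norm (g k y))"
        proof (rule summable_comparison_test)
          show "\<exists>N. \<forall>k\<ge>N. norm (norm (g k y)) \<le> norm (f y) * ((R1 / 2) ^ ?n * (norm (w * of_real (R1\<^sup>2)) ^ k / fact k))"
          proof (intro exI[of _ 0] allI impI)
            fix k
            show "norm (norm (g k y)) \<le> norm (f y) * ((R1 / 2) ^ ?n * (norm (w * of_real (R1\<^sup>2)) ^ k / fact k))"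
              using mult_left_mono[OF bnd norm_ge_zero[of "f y"], of y k w]
              by (cases "f y = 0") (simp_all add: g_def norm_mult)
          qed
        qed (intro summable_mult sumE)
      qed
      show "summable (\<lambda>k. \<integral>y. norm (g k y) \<partial>lborel)"
      proof (rule summable_comparison_test)
        show "\<exists>N. \<forall>k\<ge>N. norm (\<integral>y. norm (g k y) \<partial>lborel) \<le> (R1 / 2) ^ ?n * (norm (w * of_real (R1\<^sup>2)) ^ k / fact k) * (\<integral>y. norm (f y) \<partial>lborel)"
        proof (intro exI[of _ 0] allI impI)
          fix k
          have "(\<integral>y. norm (g k y) \<partial>lborel) \<le> (R1 / 2) ^ ?n * (norm (w * of_real (R1\<^sup>2)) ^ k / fact k) * (\<integral>y. norm (f y) \<partial>lborel)"
            unfolding g_def by (rule integrable_mult_bounded(3)[OF f _ bnd]) measurable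
          then show "norm (\<integral>y. norm (g k y) \<partial>lborel) \<le> \<dots>" by simp
        qed
      qed (intro summable_mult2 summable_mult sumE)
    qed
    moreover have "(\<integral>y. (\<Sum>k. g k y) \<partial>lborel) = P w"
      unfolding P_def using sums_unique[OF sumf] by simp
    ultimately show ?thesis by (simp add: gm[abs_def])
  qed
  have Phol: "P holomorphic_on UNIV"
  proof -
    have "P holomorphic_on ball 0 r" for r
      by (rule power_series_holomorphic[where a = "\<lambda>k. \<integral>y. m k y \<partial>lborel"]) (use S in simp)
    then have "P field_differentiable (at w)" for w
      using holomorphic_on_imp_differentiable_at[of P "ball 0 (norm w + 1)" w] by simp
    then show ?thesis by (simp add: holomorphic_on_def)
  qed
  have eq: "hankel_coeff f l z = 1 / (2 * of_real pi) * (z ^ ?n * P (z ^ 2))" for z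
  proof -
    have "f y * (angular_factor l y * bessel_J ?n (z * of_real (norm y)))
      = z ^ ?n * (f y * (angular_factor l y * of_real (norm y / 2) ^ ?n * bessel_profile ?n (z ^ 2 * of_real ((norm y)\<^sup>2))))" for y
      by (simp add: bessel_J_eq_profile power_mult_distrib power_divide mult_ac)
    then show ?thesis unfolding hankel_coeff_plane P_def by (simp only: integral_mult_right_zero)
  qed
  have "(P \<circ> (\<lambda>z. z ^ 2)) holomorphic_on UNIV"
    by (intro holomorphic_on_compose holomorphic_intros holomorphic_on_subset[OF Phol]) auto
  then show ?thesis unfolding eq[abs_def] comp_def by (intro holomorphic_intros) auto
qed

lemma holomorphic_inversion_integrand: "inversion_integrand f l r holomorphic_on UNIV"
proof -
  have "(bessel_J (nat \<bar>l\<bar>) \<circ> (\<lambda>z. z * of_real r)) holomorphic_on UNIV"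
    by (intro holomorphic_on_compose holomorphic_intros holomorphic_bessel_J)
  then show ?thesis
    unfolding inversion_integrand_def[abs_def] comp_def
    by (intro holomorphic_intros holomorphic_hankel_coeff)
qed

lemma norm_inversion_integrand_le:
  assumes "r \<ge> 0"
  shows "norm (inversion_integrand f l r z)
     \<le> (\<integral>y. norm (f y) \<partial>lborel) / (2 * pi) * norm z * exp ((R1 + r) * \<bar>Im z\<bar>)"
proof -
  have b: "norm (bessel_J (nat \<bar>l\<bar>) (z * of_real r)) \<le> exp (r * \<bar>Im z\<bar>)"
    using norm_bessel_J_le[of "nat \<bar>l\<bar>" "z * of_real r"] assms by (simp add: abs_mult mult.commute)
  have "norm (inversion_integrand f l r z) = norm (hankel_coeff f l z) * norm (bessel_J (nat \<bar>l\<bar>) (z * of_real r)) * norm z"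
    by (simp add: inversion_integrand_def norm_mult)
  also have "\<dots> \<le> (exp (R1 * \<bar>Im z\<bar>) * (\<integral>y. norm (f y) \<partial>lborel) / (2 * pi)) * exp (r * \<bar>Im z\<bar>) * norm z"
    by (intro mult_right_mono mult_mono norm_hankel_coeff_le b) auto
  moreover have "exp ((R1 + r) * \<bar>Im z\<bar>) = exp (R1 * \<bar>Im z\<bar>) * exp (r * \<bar>Im z\<bar>)"
    by (simp only: distrib_right exp_add)
  ultimately show ?thesis by (simp add: mult_ac)
qed

text \<open>
Both truncated integrals are values of one primitive \<open>H\<close>, at \<open>b\<close> and at \<open>b + \<i> a\<close>, and \<open>H\<close> has at most
quadratic growth times \<open>exp ((R1 + r) |Im z|)\<close>; so the limits along the two horizontal lines agree.
\<close>

lemma unbounded_contour_integrals_agree: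
  assumes r: "0 \<le> r" and R1: "0 \<le> R1"
  shows "has_unbounded_contour_integral (inversion_integrand f l r) I axis_part \<longleftrightarrow>
         has_unbounded_contour_integral (inversion_integrand f l r) I (contour_part a)"
proof -
  define h where "h = inversion_integrand f l r"
  have h: "h holomorphic_on UNIV" unfolding h_def by (rule holomorphic_inversion_integrand)
  obtain g where g: "\<And>z. (g has_field_derivative h z) (at z)"
    using holomorphic_convex_primitive'[OF convex_UNIV open_UNIV h] by auto
  define H where "H = (\<lambda>z. g z - g 0)"
  have H: "(H has_field_derivative h z) (at z)" for z
    using DERIV_diff[OF g DERIV_const[of "g 0"]] by (simp add: H_def)
  have H0: "H 0 = 0" by (simp add: H_def)
  have prim: "(h has_contour_integral (H (pathfinish \<gamma>) - H (pathstart \<gamma>))) \<gamma>" if "valid_path \<gamma>" for \<gamma>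
    by (rule contour_integral_primitive[where S = UNIV]) (use H that in auto)
  have axis: "(h has_contour_integral H (Complex b 0)) (axis_part b)" for b
    using prim[of "axis_part b"] by (simp add: axis_part_def H0 complex_of_real_def)
  have cont: "(h has_contour_integral H (Complex b a)) (contour_part a b)" for b
  proof -
    have "\<i> * of_real a + of_real b = Complex b a" by (simp add: complex_eq_iff)
    then show ?thesis using prim[of "contour_part a b"] by (simp add: contour_part_def H0)
  qed
  have Hhol: "H holomorphic_on UNIV"
    using H by (auto simp: holomorphic_on_def field_differentiable_def)
  define M where "M = (\<integral>y. norm (f y) \<partial>lborel) / (2 * pi)"
  have M: "M \<ge> 0" by (simp add: M_def)
  have growth: "norm (H z) \<le> M * (1 + norm z) ^ 2 * exp ((R1 + r) * \<bar>Im z\<bar>)" for z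
  proof -
    have "(h has_contour_integral H z) (linepath 0 z)" using prim[of "linepath 0 z"] by (simp add: H0)
    then have "norm (H z) \<le> (M * norm z * exp ((R1 + r) * \<bar>Im z\<bar>)) * norm (z - 0)"
    proof (rule has_contour_integral_bound_linepath)
      show "0 \<le> M * norm z * exp ((R1 + r) * \<bar>Im z\<bar>)" using M by simp
      fix x assume "x \<in> closed_segment 0 z"
      then obtain t where t: "0 \<le> t" "t \<le> 1" "x = of_real t * z"
        by (auto simp: closed_segment_def scaleR_conv_of_real)
      have 1: "norm x \<le> norm z" using t by (simp add: norm_mult mult_left_le_one_le)
      have 2: "\<bar>Im x\<bar> \<le> \<bar>Im z\<bar>" using t by (simp add: abs_mult mult_left_le_one_le)
      have "norm (h x) \<le> M * norm x * exp ((R1 + r) * \<bar>Im x\<bar>)"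
        unfolding h_def M_def by (rule norm_inversion_integrand_le[OF r])
      also have "\<dots> \<le> M * norm z * exp ((R1 + r) * \<bar>Im z\<bar>)"
        using 1 2 M r R1 by (intro mult_mono) (auto intro: mult_left_mono)
      finally show "norm (h x) \<le> M * norm z * exp ((R1 + r) * \<bar>Im z\<bar>)" .
    qed
    also have "\<dots> = M * (norm z)\<^sup>2 * exp ((R1 + r) * \<bar>Im z\<bar>)" by (simp add: power2_eq_square)
    also have "\<dots> \<le> M * (1 + norm z) ^ 2 * exp ((R1 + r) * \<bar>Im z\<bar>)"
      using M by (intro mult_right_mono mult_left_mono power_mono) auto
    finally show ?thesis .
  qed
  have line: "((\<lambda>b. H (Complex b y1)) \<longlongrightarrow> I) at_top \<Longrightarrow> ((\<lambda>b. H (Complex b y2)) \<longlongrightarrow> I) at_top" for y1 y2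
    by (rule tendsto_horizontal_line[OF Hhol _ growth]) (use r R1 in auto)
  have "h contour_integrable_on axis_part b" "h contour_integrable_on contour_part a b"
    "contour_integral (axis_part b) h = H (Complex b 0)"
    "contour_integral (contour_part a b) h = H (Complex b a)" for b
    using has_contour_integral_integrable[OF axis] has_contour_integral_integrable[OF cont]
      contour_integral_unique[OF axis] contour_integral_unique[OF cont] by simp_all
  then show ?thesis
    unfolding has_unbounded_contour_integral_def h_def[symmetric]
    using line[of 0 a] line[of a 0] by (simp only:) blast
qed

end

section \<open>Decay of \<open>J_0\<close> on the real axis\<close>

lemma integrable_indicator_Icc: "integrable lborel (indicat_real {a..b})" for a b :: real
  by (rule integrable_real_indicator) (auto simp: emeasure_lborel_Icc_eq)

lemma bessel_J_of_real: "bessel_J n (of_real t) = of_real (Re (bessel_J n (of_real t)))"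
proof -
  have "cnj (bessel_J n (of_real t)) = bessel_J n (of_real t)"
    using bessel_J_cnj[of n "of_real t"] by simp
  then show ?thesis by (simp add: complex_eq_iff)
qed

text \<open>
The energy \<open>E = t (J_0\<^sup>2 + J_1\<^sup>2) - J_0 J_1\<close> has derivative \<open>J_0 J_1 / t \<le> 1 / t\<close>, so it grows at most
logarithmically. This crude decay of \<open>J_0\<close> suffices and avoids the asymptotic expansion.
\<close>

lemma bessel_J_0_square_le:
  assumes "t \<ge> 1"
  shows "t * norm (bessel_J 0 (of_real t)) ^ 2 \<le> 4 + ln t"
proof -
  define y where "y = (\<lambda>t. Re (bessel_J 0 (of_real t)))"
  define v where "v = (\<lambda>t. Re (of_real t * bessel_J 1 (of_real t)))"
  define u where "u = (\<lambda>t. Re (bessel_J 1 (of_real t)))"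
  have vu: "v t = t * u t" for t by (simp add: v_def u_def)
  have y': "(y has_real_derivative - u t) (at t)" for t
    using has_field_derivative_Re[OF has_vector_derivative_real_field[OF bessel_J_0_deriv[of "of_real t"]]]
    by (simp add: y_def[abs_def] u_def)
  have v': "(v has_real_derivative t * y t) (at t)" for t
    using has_field_derivative_Re[OF has_vector_derivative_real_field[OF z_bessel_J_1_deriv[of "of_real t"]]]
    by (simp add: y_def v_def[abs_def])
  have yb: "\<bar>y t\<bar> \<le> 1" and ub: "\<bar>u t\<bar> \<le> 1" for t
    using order_trans[OF abs_Re_le_cmod norm_bessel_J_real_le] by (auto simp: y_def u_def)
  define E where "E = (\<lambda>t. t * (y t)\<^sup>2 + (v t)\<^sup>2 / t - y t * v t / t)"
  have E_eq: "E t = t * (y t)\<^sup>2 + t * (u t)\<^sup>2 - y t * u t" if "t > 0" for t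
    using that by (simp add: E_def vu power2_eq_square)
  have yu: "\<bar>y t * u t\<bar> \<le> 1" for t
    unfolding abs_mult using mult_mono[OF yb ub] by auto
  have "E t - ln t \<le> E 1 - ln 1"
  proof (rule DERIV_nonpos_imp_nonincreasing[of 1 t "\<lambda>t. E t - ln t"])
    fix x :: real assume "1 \<le> x"
    then have x: "x > 0" by simp
    have "(E has_real_derivative (y x * u x / x)) (at x)"
    proof -
      have alg: "(Y\<^sup>2 * 1 + 2 * Y * (- U) * x) + ((2 * (x * U) * (x * Y)) * x - (x * U)\<^sup>2 * 1) / (x * x)
          - ((- U * (x * U) + x * Y * Y) * x - Y * (x * U) * 1) / (x * x) = Y * U / x" for Y U :: real
        using x by (simp add: field_simps power2_eq_square)
      have "(E has_real_derivative ((y x)\<^sup>2 * 1 + 2 * y x * (- u x) * x) + ((2 * v x * (x * y x)) * x - (v x)\<^sup>2 * 1) / (x * x)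
          - ((- u x * v x + x * y x * y x) * x - y x * v x * 1) / (x * x)) (at x)"
        unfolding E_def
      proof (intro DERIV_diff DERIV_add DERIV_divide DERIV_mult DERIV_ident y' v')
        show "((\<lambda>t. t * (y t)\<^sup>2) has_real_derivative (y x)\<^sup>2 * 1 + 2 * y x * (- u x) * x) (at x)"
          using DERIV_mult[OF DERIV_ident DERIV_power[OF y'[of x], of 2]] by (simp add: mult_ac)
        show "((\<lambda>t. (v t)\<^sup>2) has_real_derivative 2 * v x * (x * y x)) (at x)"
          using DERIV_power[OF v'[of x], of 2] by (simp add: mult_ac)
      qed (use x in auto)
      then show ?thesis unfolding vu alg .
    qed
    then have "((\<lambda>t. E t - ln t) has_real_derivative (y x * u x / x - inverse x)) (at x)"
      using x by (intro DERIV_diff DERIV_ln)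
    moreover have "y x * u x / x - inverse x \<le> 0"
    proof -
      have "y x * u x / x \<le> 1 / x" using yu[of x] x by (intro divide_right_mono) auto
      then show ?thesis by (simp add: divide_inverse)
    qed
    ultimately show "\<exists>z. ((\<lambda>t. E t - ln t) has_real_derivative z) (at x) \<and> z \<le> 0" by blast
  qed (rule assms)
  moreover have "E 1 \<le> 3"
  proof -
    have "(y 1)\<^sup>2 \<le> 1" "(u 1)\<^sup>2 \<le> 1" using yb[of 1] ub[of 1] by (auto simp: abs_square_le_1)
    then show ?thesis using yu[of 1] E_eq[of 1] by simp
  qed
  ultimately have "E t \<le> 3 + ln t" by simp

  moreover have "t * (y t)\<^sup>2 - 1 \<le> E t"
  proof -
    have "0 \<le> t * (u t)\<^sup>2" using assms by simp
    moreover have "y t * u t \<le> 1" using yu[of t] by linarith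
    moreover have "E t = t * (y t)\<^sup>2 + t * (u t)\<^sup>2 - y t * u t" using E_eq assms by simp
    ultimately show ?thesis by linarith
  qed
  moreover have "norm (bessel_J 0 (of_real t)) = \<bar>y t\<bar>"
    by (subst bessel_J_of_real) (simp add: y_def)
  ultimately show ?thesis by simp
qed

lemma bessel_J_0_tendsto_0: "((\<lambda>t. norm (bessel_J 0 (of_real t))) \<longlongrightarrow> 0) at_top"
proof -
  have "((\<lambda>t::real. 4 / t + ln t / t) \<longlongrightarrow> 0 + 0) at_top"
    by (intro tendsto_add ln_x_over_x_tendsto_0 tendsto_divide_0[OF tendsto_const] filterlim_at_top_imp_at_infinity filterlim_ident)
  then have lim: "((\<lambda>t::real. 4 / t + ln t / t) \<longlongrightarrow> 0) at_top" by simp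
  have "((\<lambda>t. norm (bessel_J 0 (of_real t)) ^ 2) \<longlongrightarrow> 0) at_top"
  proof (rule tendsto_sandwich[OF _ _ tendsto_const lim])
    show "\<forall>\<^sub>F t in at_top. 0 \<le> norm (bessel_J 0 (of_real t)) ^ 2" by simp
    show "\<forall>\<^sub>F t in at_top. norm (bessel_J 0 (of_real t)) ^ 2 \<le> 4 / t + ln t / t"
      using eventually_ge_at_top[of 1]
    proof eventually_elim
      case (elim t)
      then show ?case using bessel_J_0_square_le[of t] by (simp add: field_simps)
    qed
  qed
  then have "((\<lambda>t. sqrt (norm (bessel_J 0 (of_real t)) ^ 2)) \<longlongrightarrow> sqrt 0) at_top"
    by (rule tendsto_real_sqrt)
  then show ?thesis by simp
qed

lemma integral_norm_bessel_J_0_tendsto_0: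
  "((\<lambda>b. integral {0..L} (\<lambda>\<rho>. norm (bessel_J 0 (of_real (b * \<rho>))))) \<longlongrightarrow> 0) at_top"
proof -
  have eq: "integral {0..L} (\<lambda>\<rho>. norm (bessel_J 0 (of_real (b * \<rho>))))
      = (\<integral>\<rho>. indicator {0..L} \<rho> *\<^sub>R norm (bessel_J 0 (of_real (b * \<rho>))) \<partial>lborel)" for b
    by (subst set_borel_integral_eq_integral(2)[symmetric])
       (auto intro!: borel_integrable_atLeastAtMost' continuous_intros simp: set_lebesgue_integral_def)
  have "((\<lambda>b. \<integral>\<rho>. indicator {0..L} \<rho> *\<^sub>R norm (bessel_J 0 (of_real (b * \<rho>))) \<partial>lborel)
     \<longlongrightarrow> (\<integral>\<rho>. 0 \<partial>(lborel :: real measure))) at_top"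
  proof (rule integral_dominated_convergence_at_top)
    show "integrable lborel (\<lambda>\<rho>. indicator {0..L} \<rho> :: real)" by (rule integrable_indicator_Icc)
    have "(\<lambda>\<rho>. norm (bessel_J 0 (of_real (b * \<rho>)))) \<in> borel_measurable borel" for b
      by (intro borel_measurable_continuous_onI continuous_intros)
    then show "(\<lambda>\<rho>. indicator {0..L} \<rho> *\<^sub>R norm (bessel_J 0 (of_real (b * \<rho>)))) \<in> borel_measurable lborel" for b
      by measurable
    show "\<forall>\<^sub>F b in at_top. AE \<rho> in lborel. norm (indicator {0..L} \<rho> *\<^sub>R norm (bessel_J 0 (of_real (b * \<rho>)))) \<le> indicator {0..L} \<rho>"
      using norm_bessel_J_real_le by (intro always_eventually allI AE_I2) (auto simp: indicator_def simp del: of_real_mult)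
    show "AE \<rho> in lborel. ((\<lambda>b. indicator {0..L} \<rho> *\<^sub>R norm (bessel_J 0 (of_real (b * \<rho>)))) \<longlongrightarrow> 0) at_top"
      using AE_lborel_singleton[of "0::real"]
    proof eventually_elim
      case (elim \<rho>)
      show ?case
      proof (cases "\<rho> \<in> {0..L}")
        case True
        with elim have "filterlim (\<lambda>b. b * \<rho>) at_top at_top"
          by (intro filterlim_at_top_mult_tendsto_pos[OF tendsto_const] filterlim_ident) auto
        from filterlim_compose[OF bessel_J_0_tendsto_0 this] True show ?thesis by simp
      qed simp
    qed
  qed simp
  then show ?thesis unfolding eq by (simp only: Bochner_Integration.integral_zero)
qed

section \<open>Plane waves and the addition theorem\<close>

lemma polar_form:
  fixes v :: "real \<times> real"
  obtains \<phi> where "v = (norm v * cos \<phi>, norm v * sin \<phi>)"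
proof (cases "v = 0")
  case False
  have "(fst v / norm v)\<^sup>2 + (snd v / norm v)\<^sup>2 = ((fst v)\<^sup>2 + (snd v)\<^sup>2) / (norm v)\<^sup>2"
    by (simp add: power_divide add_divide_distrib)
  also have "(fst v)\<^sup>2 + (snd v)\<^sup>2 = (norm v)\<^sup>2" by (simp add: norm_prod_def)
  also have "(norm v)\<^sup>2 / (norm v)\<^sup>2 = 1" using False by simp
  finally obtain t where "fst v / norm v = cos t" "snd v / norm v = sin t"
    by (rule sincos_total_2pi)
  moreover have "v = (norm v * (fst v / norm v), norm v * (snd v / norm v))" using False by simp
  ultimately have "v = (norm v * cos t, norm v * sin t)" by metis
  then show ?thesis by (rule that)
qed (use that in \<open>simp add: zero_prod_def\<close>)

text \<open>
Averaging plane waves of frequency \<open>t\<close> over all directions gives the radial wave \<open>J_0(t |v|)\<close>.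
\<close>

lemma has_integral_plane_wave:
  fixes v :: "real \<times> real"
  shows "((\<lambda>\<tau>. exp (\<i> * of_real (t * (fst v * cos \<tau> + snd v * sin \<tau>)))) has_integral
     2 * of_real pi * bessel_J 0 (of_real (t * norm v))) {0..2*pi}"
proof -
  obtain \<phi> where v: "v = (norm v * cos \<phi>, norm v * sin \<phi>)" by (rule polar_form)
  have e: "\<i> * of_real (t * (fst v * cos \<tau> + snd v * sin \<tau>)) = \<i> * of_real (t * norm v) * of_real (cos (\<tau> - \<phi>))" for \<tau>
    by (subst (1 2) v) (simp add: cos_diff algebra_simps)
  show ?thesis unfolding e using has_integral_bessel[of "of_real (t * norm v)" \<phi> 0] by simp
qed

text \<open>
The integrated form of Graf's addition theorem. Write \<open>J_0\<close> as an average of plane waves over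
directions \<open>\<tau>\<close>; each wave factors into a function of \<open>\<theta> - \<tau>\<close> and a function of \<open>\<tau> - \<phi>\<close>, and after exchanging
the integrals Bessel's integral applies twice. The powers of \<open>\<i>\<close> cancel because the second factor has
the argument \<open>- t |y|\<close>.
\<close>

lemma bessel_J_addition:
  fixes y :: "real \<times> real"
  assumes y: "y \<noteq> 0"
  shows "integral {0..2*pi} (\<lambda>\<theta>. cis (- (of_int l * \<theta>)) * bessel_J 0 (of_real (t * norm ((r * cos \<theta>, r * sin \<theta>) - y))))
    = 2 * of_real pi * bessel_J (nat \<bar>l\<bar>) (of_real (t * r)) * bessel_J (nat \<bar>l\<bar>) (of_real (t * norm y)) * angular_factor l y"
proof -
  let ?n = "nat \<bar>l\<bar>"
  define s where "s = norm y"
  have s: "s > 0" using y by (simp add: s_def)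
  obtain \<phi> where yp: "y = (s * cos \<phi>, s * sin \<phi>)" unfolding s_def by (rule polar_form)
  define w where "w = (\<lambda>\<theta> \<tau>. cis (- (of_int l * \<theta>)) *
     (exp (\<i> * of_real (t * r) * of_real (cos (\<theta> - \<tau>))) * exp (\<i> * (- of_real (t * s)) * of_real (cos (\<tau> - \<phi>)))))"
  have wave: "integral {0..2*pi} (w \<theta>) = cis (- (of_int l * \<theta>)) * (2 * of_real pi * bessel_J 0 (of_real (t * norm ((r * cos \<theta>, r * sin \<theta>) - y))))" for \<theta>
  proof -
    have "\<i> * of_real (t * (fst ((r * cos \<theta>, r * sin \<theta>) - y) * cos \<tau> + snd ((r * cos \<theta>, r * sin \<theta>) - y) * sin \<tau>))
        = \<i> * of_real (t * r) * of_real (cos (\<theta> - \<tau>)) + \<i> * (- of_real (t * s)) * of_real (cos (\<tau> - \<phi>))" for \<tau>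
      by (simp add: yp cos_diff algebra_simps)
    then have "w \<theta> = (\<lambda>\<tau>. cis (- (of_int l * \<theta>)) * exp (\<i> * of_real (t * (fst ((r * cos \<theta>, r * sin \<theta>) - y) * cos \<tau> + snd ((r * cos \<theta>, r * sin \<theta>) - y) * sin \<tau>))))"
      by (simp only: w_def exp_add)
    then show ?thesis
      using has_integral_mult_right[OF has_integral_plane_wave] by (simp only: integral_unique)
  qed
  have "2 * of_real pi * integral {0..2*pi} (\<lambda>\<theta>. cis (- (of_int l * \<theta>)) * bessel_J 0 (of_real (t * norm ((r * cos \<theta>, r * sin \<theta>) - y))))
     = integral {0..2*pi} (\<lambda>\<theta>. integral {0..2*pi} (w \<theta>))"
    unfolding wave by (simp add: mult_ac flip: integral_mult_right)
  also have "\<dots> = integral {0..2*pi} (\<lambda>\<tau>. integral {0..2*pi} (\<lambda>\<theta>. w \<theta> \<tau>))"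
    unfolding cbox_interval[symmetric]
    by (rule integral_swap_continuous) (auto simp: w_def case_prod_unfold intro!: continuous_intros)
  also have "\<dots> = integral {0..2*pi} (\<lambda>\<tau>. (2 * of_real pi * \<i> ^ ?n * bessel_J ?n (of_real (t * r))) *
      (exp (\<i> * (- of_real (t * s)) * of_real (cos (\<tau> - \<phi>))) * cis (- (of_int l * \<tau>))))"
  proof (rule integral_cong)
    fix \<tau> :: real
    have "w \<theta> \<tau> = exp (\<i> * of_real (t * r) * of_real (cos (\<theta> - \<tau>))) * cis (- (of_int l * \<theta>)) * exp (\<i> * (- of_real (t * s)) * of_real (cos (\<tau> - \<phi>)))" for \<theta>
      by (simp only: w_def mult_ac)
    then show "integral {0..2*pi} (\<lambda>\<theta>. w \<theta> \<tau>) = (2 * of_real pi * \<i> ^ ?n * bessel_J ?n (of_real (t * r))) *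
      (exp (\<i> * (- of_real (t * s)) * of_real (cos (\<tau> - \<phi>))) * cis (- (of_int l * \<tau>)))"
      using has_integral_mult_left[OF has_integral_bessel[of "of_real (t * r)" \<tau> l], of "exp (\<i> * (- of_real (t * s)) * of_real (cos (\<tau> - \<phi>)))"]
      by (simp only: integral_unique mult_ac)
  qed
  also have "\<dots> = (2 * of_real pi * \<i> ^ ?n * bessel_J ?n (of_real (t * r))) *
      (2 * of_real pi * \<i> ^ ?n * cis (- (of_int l * \<phi>)) * bessel_J ?n (- of_real (t * s)))"
    using has_integral_mult_right[OF has_integral_bessel[of "- of_real (t * s)" \<phi> l]] by (rule integral_unique)
  also have "\<dots> = (\<i> ^ ?n * \<i> ^ ?n * (-1) ^ ?n) * (2 * of_real pi * (2 * of_real pi * bessel_J ?n (of_real (t * r)) * bessel_J ?n (of_real (t * s)) * cis (- (of_int l * \<phi>))))"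
    unfolding bessel_J_minus by (simp only: mult_ac)
  also have "\<i> ^ ?n * \<i> ^ ?n * (-1) ^ ?n = (1::complex)"
    by (simp flip: power_mult_distrib)
  also have "cis (- (of_int l * \<phi>)) = angular_factor l y"
    unfolding yp by (rule angular_factor_polar[OF s, symmetric])
  finally show ?thesis by (simp add: s_def)
qed

section \<open>Integrals over an interval and the plane\<close>

lemma bounded_on_compact_real_plane:
  fixes k :: "real \<Rightarrow> real \<times> real \<Rightarrow> complex"
  assumes "continuous_on UNIV (\<lambda>(t, y). k t y)"
  obtains B where "B \<ge> 0" "\<And>t y. t \<in> {c..d} \<Longrightarrow> norm y \<le> R \<Longrightarrow> norm (k t y) \<le> B"
proof -
  have co: "compact ((\<lambda>(t, y). k t y) ` ({c..d} \<times> cball 0 R))"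
    by (intro compact_continuous_image continuous_on_subset[OF assms] compact_Times) auto
  then obtain B where B: "\<And>x. x \<in> (\<lambda>(t, y). k t y) ` ({c..d} \<times> cball 0 R) \<Longrightarrow> norm x \<le> B"
    using compact_imp_bounded[OF co] unfolding bounded_iff by blast
  have "norm (k t y) \<le> max B 0" if "t \<in> {c..d}" "norm y \<le> R" for t y
    using B[of "k t y"] that by force
  then show ?thesis using that[of "max B 0"] by auto
qed

text \<open>
Fubini's theorem: since \<open>f\<close> vanishes outside a disc, only values of \<open>k\<close> on a compact set matter, and
continuity makes them bounded.
\<close>

lemma swap_interval_plane:
  fixes f :: "real \<times> real \<Rightarrow> complex" and k :: "real \<Rightarrow> real \<times> real \<Rightarrow> complex"
  assumes f: "integrable lborel f" and supp: "\<And>x. norm x > R \<Longrightarrow> f x = 0"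
    and k: "continuous_on UNIV (\<lambda>(t, y). k t y)"
  shows "set_integrable lborel {c..d} (\<lambda>t. \<integral>y. f y * k t y \<partial>lborel)"
    and "(LBINT t:{c..d}. \<integral>y. f y * k t y \<partial>lborel) = (\<integral>y. f y * integral {c..d} (\<lambda>t. k t y) \<partial>lborel)"
proof -
  obtain B where B: "B \<ge> 0" "\<And>t y. t \<in> {c..d} \<Longrightarrow> norm y \<le> R \<Longrightarrow> norm (k t y) \<le> B"
    using bounded_on_compact_real_plane[OF k] by blast
  have fm[measurable]: "f \<in> borel_measurable borel" using f by auto
  have km[measurable]: "(\<lambda>(t, y). k t y) \<in> borel_measurable (lborel \<Otimes>\<^sub>M lborel)"
    using borel_measurable_continuous_onI[OF k] by (simp add: lborel_prod)
  define f0 where "f0 = (\<lambda>(t, y). indicator {c..d} t * f y)"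
  have f0: "integrable (lborel \<Otimes>\<^sub>M lborel) f0"
  proof (rule lborel_pair.Fubini_integrable)
    show "f0 \<in> borel_measurable (lborel \<Otimes>\<^sub>M lborel)" unfolding f0_def by measurable
    have "(\<integral>y. norm (f0 (t, y)) \<partial>lborel) = indicator {c..d} t * (\<integral>y. norm (f y) \<partial>lborel)" for t
      by (simp add: f0_def norm_mult indicator_def)
    then show "integrable lborel (\<lambda>t. \<integral>y. norm (f0 (t, y)) \<partial>lborel)"
      by (simp add: integrable_indicator_Icc)
    show "AE t in lborel. integrable lborel (\<lambda>y. f0 (t, y))"
      using f by (intro AE_I2) (simp add: f0_def)
  qed
  have int: "integrable (lborel \<Otimes>\<^sub>M lborel) (\<lambda>p. f0 p * (case p of (t, y) \<Rightarrow> k t y))"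
  proof (rule integrable_mult_bounded(1)[OF f0 km])
    fix p assume "f0 p \<noteq> 0"
    then have "fst p \<in> {c..d}" "norm (snd p) \<le> R"
      using supp[of "snd p"] by (cases "norm (snd p) > R"; auto simp: f0_def indicator_def case_prod_unfold split: if_splits)+
    then show "norm (case p of (t, y) \<Rightarrow> k t y) \<le> B" using B(2) by (auto simp: case_prod_unfold)
  qed
  have int': "integrable (lborel \<Otimes>\<^sub>M lborel) (\<lambda>(t, y). indicator {c..d} t *\<^sub>R (f y * k t y))"
  proof -
    have "(\<lambda>p. f0 p * (case p of (t, y) \<Rightarrow> k t y)) = (\<lambda>(t, y). indicator {c..d} t *\<^sub>R (f y * k t y))"
      by (auto simp: fun_eq_iff f0_def indicator_def)
    then show ?thesis using int by (simp only:)
  qed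
  have e1: "(\<integral>y. indicator {c..d} t *\<^sub>R (f y * k t y) \<partial>lborel) = indicator {c..d} t *\<^sub>R (\<integral>y. f y * k t y \<partial>lborel)" for t
    by simp
  show "set_integrable lborel {c..d} (\<lambda>t. \<integral>y. f y * k t y \<partial>lborel)"
    using lborel_pair.integrable_fst[OF int'] unfolding set_integrable_def e1 .
  have e2: "(\<integral>t. indicator {c..d} t *\<^sub>R (f y * k t y) \<partial>lborel) = f y * integral {c..d} (\<lambda>t. k t y)" for y
  proof -
    have ky: "continuous_on {c..d} (\<lambda>t. k t y)"
    proof -
      have "continuous_on {c..d} (\<lambda>t. (t, y))" by (intro continuous_intros)
      from continuous_on_compose2[OF k this] show ?thesis by simp
    qed
    have "(\<integral>t. indicator {c..d} t *\<^sub>R (f y * k t y) \<partial>lborel) = f y * (LBINT t:{c..d}. k t y)"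
      unfolding set_lebesgue_integral_def by (simp flip: integral_mult_right_zero mult_scaleR_right)
    then show ?thesis
      using set_borel_integral_eq_integral(2)[OF borel_integrable_atLeastAtMost'[OF ky]] by simp
  qed
  have "(LBINT t:{c..d}. \<integral>y. f y * k t y \<partial>lborel) = (\<integral>t. \<integral>y. indicator {c..d} t *\<^sub>R (f y * k t y) \<partial>lborel \<partial>lborel)"
    unfolding set_lebesgue_integral_def e1 ..
  also have "\<dots> = (\<integral>y. \<integral>t. indicator {c..d} t *\<^sub>R (f y * k t y) \<partial>lborel \<partial>lborel)"
    by (rule lborel_pair.Fubini_integral[symmetric, OF int'])
  also have "\<dots> = (\<integral>y. f y * integral {c..d} (\<lambda>t. k t y) \<partial>lborel)" unfolding e2 ..
  finally show "(LBINT t:{c..d}. \<integral>y. f y * k t y \<partial>lborel) = (\<integral>y. f y * integral {c..d} (\<lambda>t. k t y) \<partial>lborel)" .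
qed

lemma norm_set_integral_le:
  fixes g :: "real \<Rightarrow> complex"
  assumes g: "set_integrable lborel {a..b} g" and "a \<le> b"
    and B: "\<And>t. t \<in> {a..b} \<Longrightarrow> norm (g t) \<le> B"
  shows "norm (LBINT t:{a..b}. g t) \<le> B * (b - a)"
proof -
  have "norm (LBINT t:{a..b}. g t) \<le> (\<integral>t. norm (indicator {a..b} t *\<^sub>R g t) \<partial>lborel)"
    unfolding set_lebesgue_integral_def by (rule integral_norm_bound)
  also have "\<dots> \<le> (\<integral>t. indicator {a..b} t * B \<partial>lborel)"
  proof (rule integral_mono)
    show "integrable lborel (\<lambda>t. norm (indicator {a..b} t *\<^sub>R g t))"
      using g unfolding set_integrable_def by (rule integrable_norm)
    show "integrable lborel (\<lambda>t. indicator {a..b} t * B)"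
      by (intro integrable_mult_left integrable_indicator_Icc)
  qed (use B in \<open>auto simp: indicator_def\<close>)
  also have "\<dots> = B * (b - a)" using \<open>a \<le> b\<close> by simp
  finally show ?thesis .
qed

section \<open>Hankel inversion for continuously differentiable functions\<close>

text \<open>
The entire function \<open>b J_1(b z) / z\<close>, written so that it is defined at \<open>z = 0\<close> as well.
\<close>

definition radial_kernel :: "real \<Rightarrow> complex \<Rightarrow> complex" where
  "radial_kernel b z = of_real (b\<^sup>2 / 2) * bessel_profile 1 ((of_real b * z)\<^sup>2)"

lemma continuous_on_bessel_profile [continuous_intros]:
  "continuous_on A g \<Longrightarrow> continuous_on A (\<lambda>x. bessel_profile n (g x))"
  by (rule continuous_on_compose2[of UNIV]) (auto intro: DERIV_continuous_on bessel_profile_deriv)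

lemma continuous_on_radial_kernel [continuous_intros]:
  "continuous_on A g \<Longrightarrow> continuous_on A (\<lambda>x. radial_kernel b (g x))"
  unfolding radial_kernel_def by (intro continuous_intros)

text \<open>
The recurrence \<open>bessel_profile_rec\<close> shows that \<open>z\<^sup>2 / 2\<close> times \<open>bessel_profile 1 ((z \<rho>)\<^sup>2)\<close> is an antiderivative of
\<open>z J_0(z \<rho>)\<close>.
\<close>

lemma has_integral_radial_kernel:
  assumes "b \<ge> 0"
  shows "((\<lambda>t. of_real t * bessel_J 0 (of_real (t * \<rho>))) has_integral radial_kernel b (of_real \<rho>)) {0..b}"
proof -
  define g where "g = (\<lambda>z. z\<^sup>2 / 2 * bessel_profile 1 ((z * of_real \<rho>)\<^sup>2))"
  have g': "(g has_field_derivative z * bessel_J 0 (z * of_real \<rho>)) (at z)" for z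
  proof -
    have "((\<lambda>z. bessel_profile 1 ((z * of_real \<rho>)\<^sup>2)) has_field_derivative
       (- bessel_profile 2 ((z * of_real \<rho>)\<^sup>2) / 4) * (2 * (z * of_real \<rho>) * of_real \<rho>)) (at z)"
      by (rule DERIV_chain'[OF _ bessel_profile_deriv[of 1, unfolded Suc_1]])
         (auto intro!: derivative_eq_intros)
    from DERIV_mult[OF DERIV_cdivide[OF DERIV_power[OF DERIV_ident, of 2], of 2] this]
    have "(g has_field_derivative z * bessel_profile 1 ((z * of_real \<rho>)\<^sup>2)
        + (- bessel_profile 2 ((z * of_real \<rho>)\<^sup>2) / 4) * (2 * (z * of_real \<rho>) * of_real \<rho>) * (z\<^sup>2 / 2)) (at z)"
      by (simp add: g_def)
    moreover have "z * bessel_profile 1 ((z * of_real \<rho>)\<^sup>2)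
        + (- bessel_profile 2 ((z * of_real \<rho>)\<^sup>2) / 4) * (2 * (z * of_real \<rho>) * of_real \<rho>) * (z\<^sup>2 / 2)
      = z * (bessel_profile 1 ((z * of_real \<rho>)\<^sup>2) - (z * of_real \<rho>)\<^sup>2 / 4 * bessel_profile 2 ((z * of_real \<rho>)\<^sup>2))"
      by (simp add: power2_eq_square algebra_simps)
    ultimately show ?thesis unfolding bessel_profile_rec by (simp add: bessel_J_eq_profile)
  qed
  have "((\<lambda>t. of_real t * bessel_J 0 (of_real t * of_real \<rho>)) has_integral (g (of_real b) - g (of_real 0))) {0..b}"
    by (rule fundamental_theorem_of_calculus[OF assms has_vector_derivative_real_field[OF g']])
  then show ?thesis by (simp add: g_def radial_kernel_def power_divide)
qed

lemma radial_kernel_mult: "of_real \<rho> * radial_kernel b (of_real \<rho>) = of_real b * bessel_J 1 (of_real (b * \<rho>))"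
  by (simp add: radial_kernel_def bessel_J_eq_profile power2_eq_square)

text \<open>
Along the ray, \<open>b J_1(b \<rho>)\<close> is the derivative of \<open>- J_0(b \<rho>)\<close>. The boundary term at \<open>\<rho> = 0\<close> is \<open>f x\<close>, since
\<open>J_0(0) = 1\<close>; the one at \<open>\<rho> = L\<close> vanishes.
\<close>

lemma radial_integral_by_parts:
  fixes f :: "real \<times> real \<Rightarrow> complex" and f' :: "real \<times> real \<Rightarrow> (real \<times> real) \<Rightarrow>\<^sub>L complex"
  assumes df: "\<And>p. (f has_derivative blinfun_apply (f' p)) (at p)" and f': "continuous_on UNIV f'"
    and L: "0 \<le> L" and zero: "f (x + L *\<^sub>R \<omega>) = 0" and \<omega>: "norm \<omega> = 1"
    and B: "\<And>p. norm (p - x) \<le> L \<Longrightarrow> norm (f' p) \<le> B"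
  shows "norm (integral {0..L} (\<lambda>\<rho>. f (x + \<rho> *\<^sub>R \<omega>) * (of_real b * bessel_J 1 (of_real (b * \<rho>)))) - f x)
    \<le> B * integral {0..L} (\<lambda>\<rho>. norm (bessel_J 0 (of_real (b * \<rho>))))"
proof -
  define u where "u = (\<lambda>\<rho>. f (x + \<rho> *\<^sub>R \<omega>))"
  define u' where "u' = (\<lambda>\<rho>. blinfun_apply (f' (x + \<rho> *\<^sub>R \<omega>)) \<omega>)"
  have du: "(u has_vector_derivative u' \<rho>) (at \<rho> within A)" for \<rho> A
  proof -
    have "((\<lambda>\<rho>. x + \<rho> *\<^sub>R \<omega>) has_derivative (\<lambda>h. h *\<^sub>R \<omega>)) (at \<rho> within A)"
      by (auto intro!: derivative_eq_intros)
    from has_derivative_compose[OF this df]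
    show ?thesis by (simp add: has_vector_derivative_def u_def u'_def blinfun.scaleR_right)
  qed
  have dj: "((\<lambda>\<rho>. bessel_J 0 (of_real (b * \<rho>))) has_vector_derivative
      - (of_real b * bessel_J 1 (of_real (b * \<rho>)))) (at \<rho> within A)" for \<rho> A
  proof -
    have "((\<lambda>z. bessel_J 0 (of_real b * z)) has_field_derivative (- bessel_J 1 (of_real b * of_real \<rho>)) * of_real b) (at (of_real \<rho>))"
      by (rule DERIV_chain2[OF bessel_J_0_deriv]) (auto intro!: derivative_eq_intros)
    from has_vector_derivative_real_field[OF this] show ?thesis by (simp add: mult.commute)
  qed
  have uc: "continuous_on {0..L} u"
    by (intro continuous_at_imp_continuous_on ballI has_vector_derivative_continuous[OF du])
  have u'c: "continuous_on {0..L} u'"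
    unfolding u'_def
    by (intro continuous_intros continuous_on_compose2[OF f']) auto
  have "((\<lambda>\<rho>. u \<rho> * - (of_real b * bessel_J 1 (of_real (b * \<rho>))) + u' \<rho> * bessel_J 0 (of_real (b * \<rho>)))
      has_integral (u L * bessel_J 0 (of_real (b * L)) - u 0 * bessel_J 0 (of_real (b * 0)))) {0..L}"
    by (rule fundamental_theorem_of_calculus[OF L has_vector_derivative_mult[OF du dj]])
  moreover have "u L = 0" "u 0 = f x" by (simp_all add: u_def zero)
  ultimately have ftc: "((\<lambda>\<rho>. u \<rho> * - (of_real b * bessel_J 1 (of_real (b * \<rho>))) + u' \<rho> * bessel_J 0 (of_real (b * \<rho>)))
      has_integral (- f x)) {0..L}" by simp
  have i: "((\<lambda>\<rho>. u' \<rho> * bessel_J 0 (of_real (b * \<rho>))) has_integral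
      integral {0..L} (\<lambda>\<rho>. u' \<rho> * bessel_J 0 (of_real (b * \<rho>)))) {0..L}"
    by (intro integrable_integral integrable_continuous_real continuous_intros u'c)
  have "((\<lambda>\<rho>. u \<rho> * (of_real b * bessel_J 1 (of_real (b * \<rho>)))) has_integral
      integral {0..L} (\<lambda>\<rho>. u' \<rho> * bessel_J 0 (of_real (b * \<rho>))) - (- f x)) {0..L}"
    using has_integral_diff[OF i ftc] by simp
  then have "integral {0..L} (\<lambda>\<rho>. u \<rho> * (of_real b * bessel_J 1 (of_real (b * \<rho>)))) - f x
     = integral {0..L} (\<lambda>\<rho>. u' \<rho> * bessel_J 0 (of_real (b * \<rho>)))"
    by (simp add: integral_unique)
  moreover have "norm (integral {0..L} (\<lambda>\<rho>. u' \<rho> * bessel_J 0 (of_real (b * \<rho>))))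
     \<le> integral {0..L} (\<lambda>\<rho>. B * norm (bessel_J 0 (of_real (b * \<rho>))))"
  proof (rule integral_norm_bound_integral)
    show "(\<lambda>\<rho>. u' \<rho> * bessel_J 0 (of_real (b * \<rho>))) integrable_on {0..L}" using i by blast
    show "(\<lambda>\<rho>. B * norm (bessel_J 0 (of_real (b * \<rho>)))) integrable_on {0..L}"
      by (intro integrable_continuous_real continuous_intros)
    fix \<rho> assume \<rho>: "\<rho> \<in> {0..L}"
    have "norm (u' \<rho>) \<le> norm (f' (x + \<rho> *\<^sub>R \<omega>)) * norm \<omega>"
      unfolding u'_def by (rule norm_blinfun)
    also have "\<dots> \<le> B" using \<rho> \<omega> by (simp add: B)
    finally show "norm (u' \<rho> * bessel_J 0 (of_real (b * \<rho>))) \<le> B * norm (bessel_J 0 (of_real (b * \<rho>)))"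
      unfolding norm_mult by (rule mult_right_mono) simp
  qed
  ultimately show ?thesis by (simp add: u_def)
qed

text \<open>
In polar coordinates around \<open>x\<close> the Jacobian \<open>\<rho>\<close> cancels the denominator of the kernel, so that the
previous lemma applies on each ray. Every ray contributes \<open>f x\<close>, hence the factor \<open>2 pi\<close>.
\<close>

lemma radial_convolution_error:
  fixes f :: "real \<times> real \<Rightarrow> complex" and f' :: "real \<times> real \<Rightarrow> (real \<times> real) \<Rightarrow>\<^sub>L complex"
  assumes int: "integrable lborel f" and supp: "\<And>x. norm x > R \<Longrightarrow> f x = 0"
    and df: "\<And>p. (f has_derivative blinfun_apply (f' p)) (at p)" and f': "continuous_on UNIV f'"
    and L: "R + norm x < L" "0 \<le> L"
    and B: "\<And>p. norm (p - x) \<le> L \<Longrightarrow> norm (f' p) \<le> B"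
  shows "norm ((\<integral>y. f y * radial_kernel b (of_real (norm (x - y))) \<partial>lborel) - 2 * of_real pi * f x)
    \<le> 2 * pi * B * integral {0..L} (\<lambda>\<rho>. norm (bessel_J 0 (of_real (b * \<rho>))))"
proof -
  define \<omega> where "\<omega> = (\<lambda>\<tau>. (cos \<tau>, sin \<tau>) :: real \<times> real)"
  have n\<omega>: "norm (\<omega> \<tau>) = 1" for \<tau> using norm_polar[of 1 \<tau>] by (simp add: \<omega>_def)
  have fc: "continuous_on UNIV f"
    using df by (intro continuous_at_imp_continuous_on ballI has_derivative_continuous)
  define g where "g = (\<lambda>y. f y * radial_kernel b (of_real (norm (x - y))))"
  have kc: "continuous_on UNIV (\<lambda>(t :: real, y). radial_kernel b (of_real (norm (x - y))))"
    by (auto simp: case_prod_unfold intro!: continuous_intros)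
  obtain M where M: "\<And>y. norm y \<le> R \<Longrightarrow> norm (radial_kernel b (of_real (norm (x - y)))) \<le> M"
    by (rule bounded_on_compact_real_plane[OF kc, of 0 0 R]) auto
  have gi: "integrable lborel g"
    unfolding g_def
  proof (rule integrable_mult_bounded(1)[OF int])
    show "(\<lambda>y. radial_kernel b (of_real (norm (x - y)))) \<in> borel_measurable lborel"
      by (simp, intro borel_measurable_continuous_onI continuous_intros)
    show "norm (radial_kernel b (of_real (norm (x - y)))) \<le> M" if "f y \<noteq> 0" for y
      using M[of y] supp[of y] that by (cases "norm y > R") auto
  qed
  have gm: "g \<in> borel_measurable borel" using gi by auto
  define h where "h = (\<lambda>v. g (x + v))"
  have hi: "integrable lborel h"
  proof -
    have "integrable (distr lborel borel ((+) x)) g" using gi by (simp add: lborel_distr_plus)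
    then show ?thesis unfolding h_def by (subst (asm) integrable_distr_eq) (use gm in auto)
  qed
  have gh: "integral\<^sup>L lborel g = integral\<^sup>L lborel h"
  proof -
    have "integral\<^sup>L lborel g = integral\<^sup>L (distr lborel borel ((+) x)) g" by (simp add: lborel_distr_plus)
    also have "\<dots> = integral\<^sup>L lborel h" unfolding h_def by (rule integral_distr) (use gm in auto)
    finally show ?thesis .
  qed
  define I where "I = (\<lambda>\<tau>. integral {0..L} (\<lambda>\<rho>. f (x + \<rho> *\<^sub>R \<omega> \<tau>) * (of_real b * bessel_J 1 (of_real (b * \<rho>)))))"
  have far: "f (x + \<rho> *\<^sub>R \<omega> \<tau>) = 0" if "\<rho> \<ge> L" for \<rho> \<tau>
  proof (rule supp)
    have "norm (\<rho> *\<^sub>R \<omega> \<tau>) \<le> norm (x + \<rho> *\<^sub>R \<omega> \<tau>) + norm x"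
      using norm_triangle_ineq4[of "x + \<rho> *\<^sub>R \<omega> \<tau>" x] by simp
    then show "R < norm (x + \<rho> *\<^sub>R \<omega> \<tau>)" using that L by (simp add: n\<omega>)
  qed
  have inner: "(LBINT \<rho>:{0..}. of_real \<rho> * h (\<rho> * cos \<tau>, \<rho> * sin \<tau>)) = I \<tau>" for \<tau>
  proof -
    have "(LBINT \<rho>:{0..}. of_real \<rho> * h (\<rho> * cos \<tau>, \<rho> * sin \<tau>))
        = (LBINT \<rho>:{0..L}. f (x + \<rho> *\<^sub>R \<omega> \<tau>) * (of_real b * bessel_J 1 (of_real (b * \<rho>))))"
      unfolding set_lebesgue_integral_def
    proof (rule Bochner_Integration.integral_cong[OF refl])
      fix \<rho> :: real
      have v: "(\<rho> * cos \<tau>, \<rho> * sin \<tau>) = \<rho> *\<^sub>R \<omega> \<tau>" by (simp add: \<omega>_def)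
      show "indicator {0..} \<rho> *\<^sub>R (of_real \<rho> * h (\<rho> * cos \<tau>, \<rho> * sin \<tau>))
        = indicator {0..L} \<rho> *\<^sub>R (f (x + \<rho> *\<^sub>R \<omega> \<tau>) * (of_real b * bessel_J 1 (of_real (b * \<rho>))))"
      proof (cases "0 \<le> \<rho>")
        case True
        have "of_real \<rho> * h (\<rho> * cos \<tau>, \<rho> * sin \<tau>)
           = f (x + \<rho> *\<^sub>R \<omega> \<tau>) * (of_real \<rho> * radial_kernel b (of_real \<rho>))"
          using True unfolding v h_def g_def by (simp add: n\<omega>)
        then show ?thesis
          unfolding radial_kernel_mult using far[of \<rho> \<tau>] True by (cases "\<rho> \<le> L") simp_all
      qed simp
    qed
    also have "\<dots> = I \<tau>"
      unfolding I_def
      by (intro set_borel_integral_eq_integral(2) borel_integrable_atLeastAtMost' continuous_intros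
          continuous_on_compose2[OF fc]) auto
    finally show ?thesis .
  qed
  have Ic: "continuous_on {0..2*pi} I"
  proof -
    have "continuous_on ({0..2*pi} \<times> cbox 0 L) (\<lambda>(\<tau>, \<rho>). f (x + \<rho> *\<^sub>R \<omega> \<tau>) * (of_real b * bessel_J 1 (of_real (b * \<rho>))))"
      unfolding case_prod_unfold \<omega>_def
      by (intro continuous_intros continuous_on_compose2[OF fc]) auto
    from integral_continuous_on_param[OF this] show ?thesis by (simp add: I_def)
  qed
  have "integral\<^sup>L lborel g = integral {0..2*pi} I"
    unfolding gh integral_polar(2)[OF hi] inner
    by (intro set_borel_integral_eq_integral(2) borel_integrable_atLeastAtMost' Ic)
  moreover have "integral {0..2*pi} (\<lambda>\<tau>. I \<tau> - f x) = integral {0..2*pi} I - 2 * of_real pi * f x"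
    by (subst Henstock_Kurzweil_Integration.integral_diff) (auto intro!: integrable_continuous_real Ic simp: scaleR_conv_of_real)
  moreover have "norm (integral {0..2*pi} (\<lambda>\<tau>. I \<tau> - f x))
      \<le> (B * integral {0..L} (\<lambda>\<rho>. norm (bessel_J 0 (of_real (b * \<rho>))))) * (2 * pi - 0)"
  proof (rule integral_bound)
    show "norm (I \<tau> - f x) \<le> B * integral {0..L} (\<lambda>\<rho>. norm (bessel_J 0 (of_real (b * \<rho>))))" for \<tau>
      unfolding I_def by (rule radial_integral_by_parts[OF df f' L(2) far n\<omega> B]) auto
  qed (auto intro!: continuous_intros Ic)
  ultimately show ?thesis by (simp add: g_def mult_ac)
qed

text \<open>
The Hankel inversion formula. By the addition theorem, and after exchanging integrals, the integral
over \<open>[0, b]\<close> is the \<open>l\<close>-th angular coefficient of the convolution with the radial kernel, whose error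
tends to \<open>0\<close> uniformly on the circle of radius \<open>r\<close>.
\<close>

lemma hankel_inversion_axis:
  fixes f :: "real \<times> real \<Rightarrow> complex"
  assumes int: "integrable lborel f" and supp: "\<And>x. norm x > R1 \<Longrightarrow> f x = 0"
    and C1: "continuously_differentiable f" and r: "0 \<le> r" and R1: "0 \<le> R1"
  shows "has_unbounded_contour_integral (inversion_integrand f l r) (angular_coeff f l r) axis_part"
proof -
  obtain f' :: "real \<times> real \<Rightarrow> (real \<times> real) \<Rightarrow>\<^sub>L complex"
    where df: "\<And>p. (f has_derivative blinfun_apply (f' p)) (at p)" and f': "continuous_on UNIV f'"
    using C1 unfolding continuously_differentiable_def by blast
  have fc: "continuous_on UNIV f"
    using df by (intro continuous_at_imp_continuous_on ballI has_derivative_continuous)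
  let ?n = "nat \<bar>l\<bar>"
  define G where "G = inversion_integrand f l r"
  \<comment> \<open>Rays of length \<open>L\<close> from a point of the circle leave the support of \<open>f\<close>.\<close>
  define L where "L = R1 + r + 1"
  define c where "c = (\<lambda>\<theta>::real. cis (- (of_int l * \<theta>)))"
  define X where "X = (\<lambda>\<theta>. (r * cos \<theta>, r * sin \<theta>))"
  define \<epsilon> where "\<epsilon> = (\<lambda>b. integral {0..L} (\<lambda>\<rho>. norm (bessel_J 0 (of_real (b * \<rho>)))))"
  have nX: "norm (X \<theta>) = r" for \<theta> using r by (simp add: X_def norm_polar)
  have Xc: "continuous_on A X" for A unfolding X_def by (intro continuous_intros)
  have cc: "continuous_on A c" for A unfolding c_def by (intro continuous_intros)
  obtain B where B: "\<And>p. norm p \<le> r + L \<Longrightarrow> norm (f' p) \<le> B"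
  proof -
    have "compact (f' ` cball 0 (r + L))"
      by (intro compact_continuous_image continuous_on_subset[OF f']) auto
    then have "bounded (f' ` cball 0 (r + L))" by (rule compact_imp_bounded)
    then obtain B where "\<forall>q \<in> f' ` cball 0 (r + L). norm q \<le> B" unfolding bounded_iff by blast
    then show ?thesis by (intro that[of B]) (simp del: split_paired_All)
  qed
  have Ghol: "G holomorphic_on UNIV"
    unfolding G_def by (rule holomorphic_inversion_integrand[OF int supp])
  define \<Theta> where "\<Theta> = (\<lambda>t y. integral {0..2*pi} (\<lambda>\<theta>. c \<theta> * bessel_J 0 (of_real (t * norm (X \<theta> - y)))))"
  have G_real: "G (of_real t) = 1 / (4 * of_real pi ^ 2) * (\<integral>y. f y * (of_real t * \<Theta> t y) \<partial>lborel)" for t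
  proof -
    \<comment> \<open>The addition theorem holds away from the origin, that is, almost everywhere.\<close>
    have \<Theta>: "\<Theta> t y = 2 * of_real pi * bessel_J ?n (of_real (t * r)) * bessel_J ?n (of_real (t * norm y)) * angular_factor l y" if "y \<noteq> 0" for y
      unfolding \<Theta>_def c_def X_def by (rule bessel_J_addition[OF that])
    have "(\<integral>y. f y * (of_real t * \<Theta> t y) \<partial>lborel)
       = (\<integral>y. (2 * of_real pi * of_real t * bessel_J ?n (of_real (t * r))) *
            (f y * (angular_factor l y * bessel_J ?n (of_real t * of_real (norm y)))) \<partial>lborel)"
    proof (rule integral_cong_AE)
      show "AE y in lborel. f y * (of_real t * \<Theta> t y) = (2 * of_real pi * of_real t * bessel_J ?n (of_real (t * r))) *
            (f y * (angular_factor l y * bessel_J ?n (of_real t * of_real (norm y))))"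
        using AE_lborel_singleton[of 0] by eventually_elim (simp add: \<Theta> mult_ac)
      have "continuous_on UNIV (\<Theta> t)"
      proof -
        have "continuous_on (UNIV \<times> cbox 0 (2*pi)) (\<lambda>(y, \<theta>). c \<theta> * bessel_J 0 (of_real (t * norm (X \<theta> - y))))"
          unfolding case_prod_unfold c_def X_def by (intro continuous_intros)
        from integral_continuous_on_param[OF this] show ?thesis by (simp add: \<Theta>_def)
      qed
      then have [measurable]: "\<Theta> t \<in> borel_measurable borel" by (rule borel_measurable_continuous_onI)
      have [measurable]: "f \<in> borel_measurable borel" using int by auto
      show "(\<lambda>y. f y * (of_real t * \<Theta> t y)) \<in> borel_measurable lborel" by measurable
      show "(\<lambda>y. (2 * of_real pi * of_real t * bessel_J ?n (of_real (t * r))) *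
            (f y * (angular_factor l y * bessel_J ?n (of_real t * of_real (norm y))))) \<in> borel_measurable lborel"
        by measurable
    qed
    also have "\<dots> = (2 * of_real pi * of_real t * bessel_J ?n (of_real (t * r))) * (2 * of_real pi * hankel_coeff f l (of_real t))"
      by (simp add: hankel_coeff_plane[OF int supp])
    finally show ?thesis by (simp add: G_def inversion_integrand_def power2_eq_square)
  qed
  have bound: "norm (contour_integral (axis_part b) G - angular_coeff f l r) \<le> B * \<epsilon> b" if b: "b > 0" for b
  proof -
    have Gc: "continuous_on {0..b} (\<lambda>t. G (of_real t))"
      by (rule continuous_on_compose2[OF holomorphic_on_imp_continuous_on[OF Ghol]]) (auto intro: continuous_intros)
    define S where "S = (\<lambda>\<theta>. \<integral>y. f y * radial_kernel b (of_real (norm (X \<theta> - y))) \<partial>lborel)"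
    have "contour_integral (axis_part b) G = integral {0..b} (\<lambda>t. G (of_real t))"
      unfolding axis_part_def using b by (subst contour_integral_linepath_Reals_eq) auto
    also have "\<dots> = (LBINT t:{0..b}. G (of_real t))"
      by (rule set_borel_integral_eq_integral(2)[symmetric, OF borel_integrable_atLeastAtMost'[OF Gc]])
    also have "\<dots> = 1 / (4 * of_real pi ^ 2) * (LBINT t:{0..b}. \<integral>y. f y * (of_real t * \<Theta> t y) \<partial>lborel)"
      unfolding G_real by (rule set_integral_mult_right)
    also have "(LBINT t:{0..b}. \<integral>y. f y * (of_real t * \<Theta> t y) \<partial>lborel)
        = (\<integral>y. f y * integral {0..b} (\<lambda>t. of_real t * \<Theta> t y) \<partial>lborel)"
    proof (rule swap_interval_plane(2)[OF int supp])
      have "continuous_on (UNIV \<times> cbox 0 (2*pi)) (\<lambda>(p, \<theta>). c \<theta> * bessel_J 0 (of_real (fst p * norm (X \<theta> - snd p))))"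
        unfolding case_prod_unfold c_def X_def by (intro continuous_intros)
      from integral_continuous_on_param[OF this]
      have "continuous_on UNIV (\<lambda>p. \<Theta> (fst p) (snd p))" by (simp add: \<Theta>_def)
      then show "continuous_on UNIV (\<lambda>(t, y). of_real t * \<Theta> t y)"
        unfolding case_prod_unfold by (intro continuous_intros)
    qed
    also have "\<dots> = (\<integral>y. f y * integral {0..2*pi} (\<lambda>\<theta>. c \<theta> * radial_kernel b (of_real (norm (X \<theta> - y)))) \<partial>lborel)"
    proof -
      have "integral {0..b} (\<lambda>t. of_real t * \<Theta> t y) = integral {0..2*pi} (\<lambda>\<theta>. c \<theta> * radial_kernel b (of_real (norm (X \<theta> - y))))" for y
      proof -
        have "integral {0..b} (\<lambda>t. of_real t * \<Theta> t y)
            = integral {0..b} (\<lambda>t. integral {0..2*pi} (\<lambda>\<theta>. of_real t * (c \<theta> * bessel_J 0 (of_real (t * norm (X \<theta> - y))))))"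
          by (simp add: \<Theta>_def)
        also have "\<dots> = integral {0..2*pi} (\<lambda>\<theta>. integral {0..b} (\<lambda>t. of_real t * (c \<theta> * bessel_J 0 (of_real (t * norm (X \<theta> - y))))))"
          unfolding cbox_interval[symmetric]
          by (rule integral_swap_continuous) (unfold case_prod_unfold c_def X_def, intro continuous_intros)
        also have "\<dots> = integral {0..2*pi} (\<lambda>\<theta>. c \<theta> * radial_kernel b (of_real (norm (X \<theta> - y))))"
        proof (rule integral_cong)
          fix \<theta>
          have "((\<lambda>t. c \<theta> * (of_real t * bessel_J 0 (of_real (t * norm (X \<theta> - y))))) has_integral
              c \<theta> * radial_kernel b (of_real (norm (X \<theta> - y)))) {0..b}"
            using b by (intro has_integral_mult_right has_integral_radial_kernel) auto
          then show "integral {0..b} (\<lambda>t. of_real t * (c \<theta> * bessel_J 0 (of_real (t * norm (X \<theta> - y)))))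
              = c \<theta> * radial_kernel b (of_real (norm (X \<theta> - y)))"
            by (simp only: mult.left_commute[of "c \<theta>"] integral_unique)
        qed
        finally show ?thesis .
      qed
      then show ?thesis by simp
    qed
    also have "\<dots> = (LBINT \<theta>:{0..2*pi}. \<integral>y. f y * (c \<theta> * radial_kernel b (of_real (norm (X \<theta> - y)))) \<partial>lborel)"
    proof (rule swap_interval_plane(2)[symmetric, OF int supp])
      show "continuous_on UNIV (\<lambda>(\<theta>, y). c \<theta> * radial_kernel b (of_real (norm (X \<theta> - y))))"
        unfolding case_prod_unfold c_def X_def by (intro continuous_intros)
    qed
    also have "\<dots> = (LBINT \<theta>:{0..2*pi}. c \<theta> * S \<theta>)"
      unfolding S_def mult.left_commute[of "f _"] by simp
    finally have T: "contour_integral (axis_part b) G = 1 / (4 * of_real pi ^ 2) * (LBINT \<theta>:{0..2*pi}. c \<theta> * S \<theta>)" .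
    have A: "angular_coeff f l r = 1 / (4 * of_real pi ^ 2) * (LBINT \<theta>:{0..2*pi}. c \<theta> * (2 * of_real pi * f (X \<theta>)))"
    proof -
      have "(LBINT \<theta>:{0..2*pi}. c \<theta> * (2 * of_real pi * f (X \<theta>)))
          = 2 * of_real pi * (LBINT \<theta>:{0..2*pi}. c \<theta> * f (X \<theta>))"
        unfolding mult.left_commute[of "c _"] by (rule set_integral_mult_right)
      then show ?thesis
        by (simp add: angular_coeff_def c_def X_def cis_conv_exp power2_eq_square mult.assoc)
    qed
    have iS: "set_integrable lborel {0..2*pi} (\<lambda>\<theta>. c \<theta> * S \<theta>)"
    proof -
      have "set_integrable lborel {0..2*pi} (\<lambda>\<theta>. \<integral>y. f y * (c \<theta> * radial_kernel b (of_real (norm (X \<theta> - y)))) \<partial>lborel)"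
      proof (rule swap_interval_plane(1)[OF int supp])
        show "continuous_on UNIV (\<lambda>(\<theta>, y). c \<theta> * radial_kernel b (of_real (norm (X \<theta> - y))))"
          unfolding case_prod_unfold c_def X_def by (intro continuous_intros)
      qed
      then show ?thesis unfolding S_def mult.left_commute[of "f _"] by simp
    qed
    have iF: "set_integrable lborel {0..2*pi} (\<lambda>\<theta>. c \<theta> * (2 * of_real pi * f (X \<theta>)))"
      by (intro borel_integrable_atLeastAtMost' continuous_intros cc continuous_on_compose2[OF fc Xc]) auto
    have "contour_integral (axis_part b) G - angular_coeff f l r
        = 1 / (4 * of_real pi ^ 2) * (LBINT \<theta>:{0..2*pi}. c \<theta> * S \<theta> - c \<theta> * (2 * of_real pi * f (X \<theta>)))"
      unfolding T A set_integral_diff(2)[OF iS iF] by (simp only: right_diff_distrib)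
    also have "norm \<dots> = 1 / (4 * pi\<^sup>2) * norm (LBINT \<theta>:{0..2*pi}. c \<theta> * S \<theta> - c \<theta> * (2 * of_real pi * f (X \<theta>)))"
      by (simp add: norm_mult norm_divide norm_power)
    also have "\<dots> \<le> 1 / (4 * pi\<^sup>2) * ((2 * pi * B * \<epsilon> b) * (2 * pi - 0))"
    proof (intro mult_left_mono norm_set_integral_le set_integral_diff(1)[OF iS iF])
      fix \<theta>
      have "norm (c \<theta> * S \<theta> - c \<theta> * (2 * of_real pi * f (X \<theta>))) = norm (S \<theta> - 2 * of_real pi * f (X \<theta>))"
        by (simp add: c_def norm_mult flip: right_diff_distrib)
      also have "\<dots> \<le> 2 * pi * B * \<epsilon> b"
        unfolding S_def \<epsilon>_def
      proof (rule radial_convolution_error[OF int supp df f'])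
        show "R1 + norm (X \<theta>) < L" "0 \<le> L" using r R1 by (simp_all add: L_def nX)
        fix p assume "norm (p - X \<theta>) \<le> L"
        then have "norm p \<le> r + L" using norm_triangle_ineq[of "p - X \<theta>" "X \<theta>"] by (simp add: nX)
        then show "norm (f' p) \<le> B" by (rule B)
      qed
      finally show "norm (c \<theta> * S \<theta> - c \<theta> * (2 * of_real pi * f (X \<theta>))) \<le> 2 * pi * B * \<epsilon> b" .
    qed auto
    also have "\<dots> = B * \<epsilon> b" by (simp add: power2_eq_square)
    finally show ?thesis .
  qed
  have "((\<lambda>b. B * \<epsilon> b) \<longlongrightarrow> B * 0) at_top"
    unfolding \<epsilon>_def by (intro tendsto_mult tendsto_const integral_norm_bessel_J_0_tendsto_0)
  then have lim: "((\<lambda>b. B * \<epsilon> b) \<longlongrightarrow> 0) at_top" by simp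
  have "\<forall>\<^sub>F b in at_top. norm (contour_integral (axis_part b) G - angular_coeff f l r) \<le> B * \<epsilon> b"
    using eventually_gt_at_top[of 0] by eventually_elim (rule bound)
  then have "((\<lambda>b. contour_integral (axis_part b) G - angular_coeff f l r) \<longlongrightarrow> 0) at_top"
    by (rule Lim_null_comparison[OF _ lim])
  then have "((\<lambda>b. contour_integral (axis_part b) G) \<longlongrightarrow> angular_coeff f l r) at_top"
    by (simp only: LIM_zero_iff)
  moreover have "G contour_integrable_on axis_part b" for b
    unfolding axis_part_def
    by (intro contour_integrable_continuous_linepath holomorphic_on_imp_continuous_on holomorphic_on_subset[OF Ghol]) auto
  ultimately show ?thesis unfolding has_unbounded_contour_integral_def G_def[symmetric] by blast
qed

theorem theorem3:
  fixes f :: "real \<times> real \<Rightarrow> complex"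
    and R0 R1 a r :: real and l :: int
  assumes "R1 > R0" and "R0 > 0" and "a > 0"
    and "integrable lborel f"
    and "\<And>x. norm x > R1 \<Longrightarrow> f x = 0"
    and "r \<in> {0..R1}"
  shows "(\<forall>I. has_unbounded_contour_integral (inversion_integrand f l r) I axis_part \<longleftrightarrow>
              has_unbounded_contour_integral (inversion_integrand f l r) I (contour_part a)) \<and>
         (continuously_differentiable f \<longrightarrow>
            has_unbounded_contour_integral (inversion_integrand f l r) (angular_coeff f l r) axis_part \<and>
            has_unbounded_contour_integral (inversion_integrand f l r) (angular_coeff f l r) (contour_part a))"
proof -
  have r: "0 \<le> r" and R1: "0 \<le> R1" using assms by auto
  have agree: "has_unbounded_contour_integral (inversion_integrand f l r) I axis_part \<longleftrightarrow>
      has_unbounded_contour_integral (inversion_integrand f l r) I (contour_part a)" for I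
    by (rule unbounded_contour_integrals_agree[OF assms(4,5) r R1])
  moreover have "continuously_differentiable f \<Longrightarrow>
      has_unbounded_contour_integral (inversion_integrand f l r) (angular_coeff f l r) axis_part"
    by (rule hankel_inversion_axis[OF assms(4,5) _ r R1])
  ultimately show ?thesis by blast
qed

end
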